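(* For every prime $p$ there exists a constant $c=c(p)>0$ such that, if $q$ is a power of $p$ with $q>c$, then $\mathbb{F}_{q^p}$ contains primitive elements that are $k$-normal over $\mathbb{F}_q$ for every integer $0\le k\le p-2$.
   Context: An element $\beta\in\mathbb{F}_{q^n}$ is $k$-normal over $\mathbb{F}_q$ if its Galois conjugates $\beta,\beta^q,\ldots,\beta^{q^{n-1}}$ span an $\mathbb{F}_q$-vector space of dimension $n-k$ (here $n=p$). An element of $\mathbb{F}_{q^n}$ is primitive if it generates the cyclic group $\mathbb{F}_{q^n}^*$. *)

theory Defs
  imports "HOL-Algebra.Embedded_Algebras" "HOL-Algebra.Multiplicative_Group"
    "HOL-Computational_Algebra.Primes" Complex_Main
begin

text \<open>
  Here \<open>F\<close> is a field of order \<open>q ^ n\<close> and \<open>K\<close> its subfield of order \<open>q\<close>, so that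
  \<open>q = card K\<close> and the list in the definition is that of the \<open>n\<close> Galois conjugates of \<open>\<beta>\<close> over \<open>K\<close>
  (with repetitions if \<open>\<beta>\<close> has degree smaller than \<open>n\<close>).
  The condition \<open>k \<le> n\<close> rules out truncation in \<open>n - k\<close>.
\<close>

definition k_normal :: "('a, 'b) ring_scheme \<Rightarrow> 'a set \<Rightarrow> nat \<Rightarrow> nat \<Rightarrow> 'a \<Rightarrow> bool" where
  "k_normal F K n k \<beta> \<longleftrightarrow>
     \<beta> \<in> carrier F \<and> k \<le> n \<and>
     ring.dimension F (n - k) K
       (ring.Span F K (map (\<lambda>i. \<beta> [^]\<^bsub>F\<^esub> (card K ^ i)) [0..<n]))"

definition primitive_element :: "('a, 'b) ring_scheme \<Rightarrow> 'a \<Rightarrow> bool" where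
  "primitive_element F \<beta> \<longleftrightarrow>
     \<beta> \<in> carrier (Multiplicative_Group.mult_of F) \<and>
     generate (Multiplicative_Group.mult_of F) {\<beta>} = carrier (Multiplicative_Group.mult_of F)"

text \<open>
  Finite fields are represented by arbitrary records over a type \<open>'a\<close>.  The type variable of a theorem
  is fixed outside all its quantifiers, so a constant claimed to exist there is uniform over all finite
  fields carried by \<open>'a\<close>.  At \<open>'a = nat\<close> these are all finite fields up to isomorphism.
\<close>

end

theory Submission
  imports Defs "HOL-Algebra.Weak_Morphisms" "HOL-Computational_Algebra.Polynomial"
begin

text \<open>
  Let \<open>D x = x\<^sup>q - x\<close> on \<open>F\<close>.  In characteristic \<open>p\<close> we have \<open>D\<^sup>p = 0\<close>, and the kernel of \<open>D\<close> is \<open>K\<close>, so that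
  \<open>\<beta>\<close> is \<open>k\<close>-normal as soon as \<open>D\<close> annihilates \<open>\<beta>\<close> in exactly \<open>p - k\<close> steps.  If \<open>\<theta>\<close> has this property and
  \<open>p - k \<ge> 2\<close>, then so have all \<open>a * (\<theta> + b)\<close> with \<open>a \<noteq> 0\<close>, \<open>b\<close> in \<open>K\<close>.  It remains to find a primitive
  element among these.  Since \<open>N = (q\<^sup>p - 1) / (q - 1)\<close> is coprime to \<open>q - 1\<close>, the factor \<open>a\<close> can be adjusted
  at the end, and it is enough that \<open>\<theta> + b\<close> is an \<open>l\<close>-th power for no prime \<open>l\<close> dividing \<open>N\<close>.

  Let \<open>X\<^sub>d\<close> be the set of all \<open>b \<in> K\<close> such that \<open>\<theta> + b\<close> is a \<open>d\<close>-th power.  Inclusion-exclusion over the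
  divisors of \<open>N\<close> succeeds once \<open>\<bar>X\<^sub>d\<bar>\<close> is \<open>q / d\<close> up to an error with a power saving.  For large \<open>d\<close> this only
  asks for a small \<open>X\<^sub>d\<close>: products of \<open>p - 1\<close> distinct elements \<open>\<theta> + b\<close>, scaled by \<open>K\<close>, are distinct \<open>d\<close>-th
  powers, because \<open>\<theta>\<close> has degree \<open>p\<close>.  For small \<open>d\<close>, Stepanov's method applies, as \<open>(\<theta> + b) ^ m\<close> is the value
  at \<open>b\<close> of the product of \<open>(X + \<theta> ^ (q ^ i)) ^ e\<^sub>i\<close>, where the \<open>e\<^sub>i\<close> are the base-\<open>q\<close> digits of \<open>m\<close>.
\<close>

hide_const (open) up_ring.monom up_ring.coeff Polynomial.order

section \<open>Polynomials and linear systems\<close>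

text \<open>Pigeonhole: the field being finite, there are more coefficient vectors than value
  vectors, and the difference of two vectors with the same values lies in the kernel.\<close>

lemma nontrivial_kernel:
  fixes c :: "'i \<Rightarrow> 'e \<Rightarrow> 'a :: {field, finite}"
  assumes "finite I" "finite E" "card E < card I"
  shows "\<exists>u. (\<exists>i\<in>I. u i \<noteq> 0) \<and> (\<forall>e\<in>E. (\<Sum>i\<in>I. u i * c i e) = 0)"
proof -
  define f where "f = (\<lambda>u. restrict (\<lambda>e. \<Sum>i\<in>I. u i * c i e) E)"
  let ?U = "I \<rightarrow>\<^sub>E (UNIV :: 'a set)" and ?W = "E \<rightarrow>\<^sub>E (UNIV :: 'a set)"
  have "card {0, 1 :: 'a} \<le> card (UNIV :: 'a set)" by (intro card_mono) auto
  hence "1 < card (UNIV :: 'a set)" by simp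
  hence "card ?W < card ?U" using assms by (simp add: card_funcsetE)
  moreover have "f ` ?U \<subseteq> ?W" by (auto simp: f_def)
  moreover have "finite ?W" using assms by (intro finite_PiE) auto
  ultimately have "\<not> inj_on f ?U"
    by (metis card_inj_on_le leD)
  then obtain u v where uv: "u \<in> ?U" "v \<in> ?U" "u \<noteq> v" "f u = f v"
    unfolding inj_on_def by blast
  have "\<exists>i\<in>I. u i - v i \<noteq> 0" using uv PiE_ext by (metis eq_iff_diff_eq_0)
  moreover have "(\<Sum>i\<in>I. (u i - v i) * c i e) = 0" if "e \<in> E" for e
    using fun_cong[OF uv(4), of e] that by (simp add: f_def left_diff_distrib sum_subtractf)
  ultimately show ?thesis by (intro exI[of _ "\<lambda>i. u i - v i"]) auto
qed

text \<open>After division by the lowest power of \<open>[:-x, 1:]\<close> that occurs with a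
  nonzero coefficient, all other terms still vanish at \<open>x\<close>, because the exponents are
  distinct.\<close>

lemma sum_distinct_orders_nonzero:
  fixes Q :: "'i \<Rightarrow> 'a :: field poly"
  assumes fin: "finite I" and inj: "inj_on r I" and Q: "\<And>i. i \<in> I \<Longrightarrow> poly (Q i) x \<noteq> 0"
    and u: "\<exists>i\<in>I. u i \<noteq> 0"
  shows "(\<Sum>i\<in>I. smult (u i) ([:-x, 1:] ^ r i * Q i)) \<noteq> 0"
proof
  assume 0: "(\<Sum>i\<in>I. smult (u i) ([:-x, 1:] ^ r i * Q i)) = 0"
  define J where "J = {i\<in>I. u i \<noteq> 0}"
  have J: "finite J" "J \<noteq> {}" using fin u by (auto simp: J_def)
  obtain i0 where i0: "i0 \<in> J" "\<And>i. i \<in> J \<Longrightarrow> r i0 \<le> r i"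
    using ex_min_if_finite[of "r ` J"] J by (metis (no_types, lifting) arg_min_if_finite(1) arg_min_least)
  have lt: "r i0 < r i" if "i \<in> J - {i0}" for i
    using i0 that inj unfolding inj_on_def J_def by (metis DiffE le_neq_implies_less mem_Collect_eq singletonI)
  have "(\<Sum>i\<in>I. smult (u i) ([:-x, 1:] ^ r i * Q i)) = (\<Sum>i\<in>J. smult (u i) ([:-x, 1:] ^ r i * Q i))"
    by (rule sum.mono_neutral_right) (auto simp: J_def fin)
  also have "\<dots> = (\<Sum>i\<in>J. [:-x, 1:] ^ r i0 * smult (u i) ([:-x, 1:] ^ (r i - r i0) * Q i))"
    by (intro sum.cong refl) (simp add: i0(2) mult.assoc[symmetric] power_add[symmetric])
  also have "\<dots> = [:-x, 1:] ^ r i0 * (\<Sum>i\<in>J. smult (u i) ([:-x, 1:] ^ (r i - r i0) * Q i))"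
    by (simp add: sum_distrib_left)
  finally have "(\<Sum>i\<in>J. smult (u i) ([:-x, 1:] ^ (r i - r i0) * Q i)) = 0"
    using 0 by simp
  hence "poly (\<Sum>i\<in>J. smult (u i) ([:-x, 1:] ^ (r i - r i0) * Q i)) x = 0" by simp
  moreover have "poly (\<Sum>i\<in>J. smult (u i) ([:-x, 1:] ^ (r i - r i0) * Q i)) x = u i0 * poly (Q i0) x"
  proof -
    have "(\<Sum>k\<in>J - {i0}. u k * (0 ^ (r k - r i0) * poly (Q k) x)) = 0"
    proof (intro sum.neutral ballI)
      fix k assume "k \<in> J - {i0}"
      from lt[OF this] show "u k * (0 ^ (r k - r i0) * poly (Q k) x) = 0" by simp
    qed
    thus ?thesis unfolding poly_sum using J(1) i0(1) by (subst sum.remove[of _ i0]) auto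
  qed
  ultimately show False using i0(1) Q by (auto simp: J_def)
qed

lemma multiple_roots_bound:
  fixes p :: "'a :: field poly"
  assumes "p \<noteq> 0" "finite S" "\<And>b. b \<in> S \<Longrightarrow> [:-b, 1:] ^ M dvd p"
  shows "M * card S \<le> degree p"
proof -
  have "repeat_mset M (mset_set S) \<subseteq># proots p"
    using assms by (auto simp: subseteq_mset_def count_mset_set' order_divides)
  hence "size (repeat_mset M (mset_set S)) \<le> size (proots p)" by (rule size_mset_mono)
  thus ?thesis using size_proots_le[of p] by simp
qed

text \<open>
  An element of \<open>'a poly poly\<close> is a polynomial in \<open>X\<close> over the ring of polynomials in \<open>U\<close>, so that setting
  \<open>X = b\<close> is evaluation at \<open>[:b:]\<close>.  Its coefficients at \<open>U ^ l\<close>, as polynomials in \<open>X\<close>, play the role of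
  Hasse derivatives of order \<open>l\<close>.
\<close>

definition wdeg_le :: "nat \<Rightarrow> nat \<Rightarrow> 'a :: comm_ring_1 poly poly \<Rightarrow> bool" where
  "wdeg_le n c P \<longleftrightarrow> (\<forall>s l. coeff (coeff P s) l \<noteq> 0 \<longrightarrow> s \<le> c + n * l)"

text \<open>The exponent of \<open>X\<close> at \<open>U ^ l\<close> has the allowance
  \<open>c + n * l\<close>. Splitting \<open>s\<close> and \<open>l\<close> between two factors
  splits the allowance, so the constants add.\<close>

lemma wdeg_le_mult:
  assumes "wdeg_le n c P" "wdeg_le n c' P'"
  shows "wdeg_le n (c + c') (P * P')"
  unfolding wdeg_le_def
proof (intro allI impI)
  fix s l assume "coeff (coeff (P * P') s) l \<noteq> 0"
  hence "(\<Sum>i\<le>s. \<Sum>j\<le>l. coeff (coeff P i) j * coeff (coeff P' (s - i)) (l - j)) \<noteq> 0"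
    by (simp add: coeff_mult coeff_sum)
  then obtain i j where ij: "i \<le> s" "j \<le> l" "coeff (coeff P i) j * coeff (coeff P' (s - i)) (l - j) \<noteq> 0"
    by (meson atMost_iff sum.not_neutral_contains_not_neutral)
  hence "i \<le> c + n * j" "s - i \<le> c' + n * (l - j)"
    using assms unfolding wdeg_le_def by (metis mult_zero_left mult_zero_right)+
  moreover have "n * l = n * j + n * (l - j)" using ij by (simp add: distrib_left[symmetric])
  ultimately show "s \<le> c + c' + n * l" using ij(1) by linarith
qed

lemma wdeg_le_mono: "wdeg_le n c P \<Longrightarrow> c \<le> c' \<Longrightarrow> wdeg_le n c' P"
  unfolding wdeg_le_def by (meson add_le_mono1 le_trans)

lemma wdeg_le_const: "wdeg_le n c [:[:a:]:]"
  by (auto simp: wdeg_le_def coeff_pCons split: nat.splits)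

lemma wdeg_le_1: "wdeg_le n c 1"
  using wdeg_le_const[of n c 1] by (simp add: one_pCons)

lemma wdeg_le_add: "wdeg_le n c P \<Longrightarrow> wdeg_le n c P' \<Longrightarrow> wdeg_le n c (P + P')"
  unfolding wdeg_le_def by (metis add_0 coeff_add)

lemma wdeg_le_power: "wdeg_le n c P \<Longrightarrow> wdeg_le n (c * k) (P ^ k)"
  by (induction k) (auto intro: wdeg_le_1 dest: wdeg_le_mult)

lemma wdeg_le_prod: "(\<And>i. i \<in> I \<Longrightarrow> wdeg_le n (c i) (P i)) \<Longrightarrow> wdeg_le n (sum c I) (prod P I)"
  by (induction I rule: infinite_finite_induct) (auto intro: wdeg_le_1 wdeg_le_mult)

lemma wdeg_le_linear: "wdeg_le n 1 [:[:a:], 1:]"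
  by (auto simp: wdeg_le_def coeff_pCons split: nat.splits)

text \<open>A factor \<open>U\<close> raises \<open>l\<close> by one and so pays for
  \<open>n\<close> degrees in \<open>X\<close>.\<close>

lemma wdeg_le_mult_U: "wdeg_le n (c + n) P \<Longrightarrow> wdeg_le n c (P * [:[:0, 1:]:])"
  unfolding wdeg_le_def
proof (intro allI impI)
  fix s l assume *: "\<forall>s l. coeff (coeff P s) l \<noteq> 0 \<longrightarrow> s \<le> c + n + n * l"
    "coeff (coeff (P * [:[:0, 1:]:]) s) l \<noteq> 0"
  then show "s \<le> c + n * l" by (cases l) (force simp: mult.commute[of P])+
qed

lemma poly_power_q_linear:
  fixes a c :: "'a :: finite_field"
  assumes "q = CHAR('a) ^ r"
  shows "[:a, c:] ^ q = [:a ^ q:] + monom (c ^ q) q"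
proof -
  have "[:a, c:] = [:a:] + monom c 1" by (simp add: monom_altdef)
  thus ?thesis
    using freshmans_dream'[of q r "[:a:]" "monom c 1"] assms
    by (simp add: monom_power poly_const_pow)
qed

lemma pcompose_power: "pcompose (p ^ n) r = pcompose p r ^ n" for p r :: "'a :: comm_ring_1 poly"
  by (induction n) (auto simp: pcompose_mult pcompose_1)

section \<open>Elementary counting in finite fields\<close>

lemma card_roots_of_unity_le:
  fixes m :: nat
  assumes "m > 0"
  shows "card {x :: 'a :: {idom, finite}. x ^ m = 1} \<le> m"
proof -
  define f :: "'a poly" where "f = monom 1 m - 1"
  have "coeff f m = 1" using assms by (simp add: f_def)
  hence "f \<noteq> 0" by auto
  moreover have "degree f \<le> m"
    unfolding f_def by (rule degree_diff_le) (auto simp: degree_monom_eq)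
  moreover have "{x. x ^ m = 1} = {x. poly f x = 0}" by (auto simp: f_def poly_monom)
  ultimately show ?thesis using card_poly_roots_bound[of f] by simp
qed

text \<open>Multiplication by \<open>x\<close> permutes \<open>S\<close>, so the product over
  \<open>S\<close> equals itself times \<open>x ^ card S\<close>.\<close>

lemma power_card_mult_closed:
  fixes S :: "'a :: field set"
  assumes S: "finite S" "0 \<notin> S" "\<And>x y. x \<in> S \<Longrightarrow> y \<in> S \<Longrightarrow> x * y \<in> S" and x: "x \<in> S"
  shows "x ^ card S = 1"
proof -
  have inj: "inj_on ((*) x) S" using x S(2) by (auto simp: inj_on_def)
  have "(*) x ` S = S" using S x inj by (intro endo_inj_surj) auto
  hence "\<Prod>S = (\<Prod>y\<in>S. x * y)" using prod.reindex[OF inj, of "\<lambda>y. y"] by simp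
  also have "\<dots> = x ^ card S * \<Prod>S" by (simp add: prod.distrib)
  finally show ?thesis using S by simp
qed

text \<open>Translation by \<open>1\<close> permutes the field, so the sum of all elements does not
  change, and the order of the field is zero in it.\<close>

lemma CHAR_eq_of_CARD:
  assumes "prime p" "card (UNIV :: 'a :: finite_field set) = p ^ n"
  shows "CHAR('a) = p"
proof -
  have "(\<Sum>x\<in>UNIV. x + 1 :: 'a) = (\<Sum>x\<in>UNIV. x)"
    by (rule sum.reindex_bij_witness[of _ "\<lambda>x. x - 1" "\<lambda>x. x + 1"]) auto
  hence "of_nat (card (UNIV :: 'a set)) = (0 :: 'a)" by (simp add: sum.distrib)
  hence "CHAR('a) dvd p ^ n" unfolding assms(2) of_nat_eq_0_iff_char_dvd .
  thus ?thesis using assms(1) by (metis CHAR_prime prime_dvd_power primes_dvd_imp_eq)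
qed

section \<open>Stepanov's method\<close>

text \<open>The left side counts zeros of an auxiliary polynomial, the right side bounds its degree.
  \<open>A \<le> e i0\<close> and \<open>d * e i0 \<le> q\<close> keep it nonzero,
  \<open>M \<le> q\<close> allows \<open>U ^ q\<close> to be dropped, and \<open>card\<close> leaves
  more unknowns than conditions.\<close>

lemma stepanov_degree_bound:
  fixes t :: "nat \<Rightarrow> 'a :: finite_field"
  assumes q: "q = CHAR('a) ^ r"
    and i0: "i0 < n" and inj: "inj_on t {..<n}"
    and S: "\<And>b. b \<in> S \<Longrightarrow> b ^ q = b" "\<And>b i. b \<in> S \<Longrightarrow> i < n \<Longrightarrow> b + t i \<noteq> 0"
      "\<And>b. b \<in> S \<Longrightarrow> (\<Prod>i<n. (b + t i) ^ e i) = \<zeta>"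
    and A: "A \<le> e i0" and e: "d * e i0 \<le> q" and M: "M \<le> q"
    and card: "(A + B + n * M) * M < A * B * d"
  shows "M * card S \<le> A + q * (B - 1) + (d - 1) * (\<Sum>i<n. e i)"
proof -
  \<comment> \<open>The auxiliary polynomial is a combination \<open>\<Phi>\<close> of the \<open>P \<iota>\<close>.  Substituting \<open>X + w * U\<close> for \<open>X\<close>, where the
    factor \<open>w\<close> clears the denominators in \<open>g (X + U) / g X\<close>, replacing \<open>g X\<close> by \<open>\<zeta>\<close> and \<open>X ^ q\<close> by \<open>X\<close>, and
    dropping \<open>U ^ q\<close> turns \<open>P \<iota>\<close> into \<open>v \<iota>\<close>.  So \<open>\<Phi>\<close> vanishes to order \<open>M\<close> on all of \<open>S\<close> if the combination
    of the \<open>v \<iota>\<close> is \<open>0\<close> modulo \<open>U ^ M\<close>, and there are fewer such conditions than unknowns.\<close>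
  define x0 where "x0 = - t i0"
  define I where "I = {..<d} \<times> {..<B} \<times> {..<A}"
  \<comment> \<open>By the weight bound below, the coefficient at \<open>U ^ l\<close> with
    \<open>l < M\<close> has degree less than \<open>A + B + n * M\<close> in \<open>X\<close>, so
    these are all the conditions.\<close>
  define E where "E = {..<A + B + n * M} \<times> {..<M}"
  define g where "g = (\<Prod>i<n. [:t i, 1:] ^ e i)"
  define P where "P = (\<lambda>(j, k, m). [:-x0, 1:] ^ (m + q * k) * g ^ j)"
  define U :: "'a poly poly" where "U = [:[:0, 1:]:]"
  define w where "w = (\<Prod>i<n. [:[:t i:], 1:])"
  define w' where "w' = (\<lambda>i. \<Prod>i'\<in>{..<n} - {i}. [:[:t i':], 1:])"
  define v where "v = (\<lambda>(j, k, m). [:[:\<zeta> ^ j:]:] * ([:[:-x0:], 1:] + w * U) ^ m *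
      [:[:- (x0 ^ q):], 1:] ^ k * (\<Prod>i<n. (1 + w' i * U) ^ e i) ^ j)"

  \<comment> \<open>The factor with exponent \<open>j\<close> costs nothing: in
    \<open>1 + w' i * U\<close> the \<open>U\<close> pays for the degree of \<open>w' i\<close>.
    This keeps the number of conditions independent of \<open>d\<close>.\<close>
  have wdeg_v: "wdeg_le n (m + k) (v (j, k, m))" for j k m
  proof -
    have w: "wdeg_le n n w"
      using wdeg_le_prod[of "{..<n}" n "\<lambda>_. 1" "\<lambda>i. [:[:t i:], 1:]"]
      by (simp add: w_def wdeg_le_linear[simplified])
    have w': "wdeg_le n n (w' i)" for i
    proof (rule wdeg_le_mono)
      show "wdeg_le n (\<Sum>i\<in>{..<n} - {i}. 1) (w' i)"
        unfolding w'_def by (intro wdeg_le_prod wdeg_le_linear)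
      show "(\<Sum>i\<in>{..<n} - {i}. 1) \<le> n"
        using card_mono[of "{..<n}" "{..<n} - {i}"] by simp
    qed
    have Y: "wdeg_le n 1 ([:[:-x0:], 1:] + w * U)"
      unfolding U_def
      by (intro wdeg_le_add wdeg_le_linear wdeg_le_mult_U wdeg_le_mono[OF w]) auto
    have Z: "wdeg_le n 0 (1 + w' i * U)" for i
      unfolding U_def
      by (intro wdeg_le_add wdeg_le_1 wdeg_le_mult_U wdeg_le_mono[OF w']) auto
    have Z': "wdeg_le n (\<Sum>i<n. 0 * e i) (\<Prod>i<n. (1 + w' i * U) ^ e i)"
      by (intro wdeg_le_prod wdeg_le_power Z)
    have "wdeg_le n (0 + 1 * m + 1 * k + (\<Sum>i<n. 0 * e i) * j) (v (j, k, m))"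
      unfolding v_def prod.case
      by (intro wdeg_le_mult wdeg_le_power Y Z' wdeg_le_linear wdeg_le_const)
    thus ?thesis by simp
  qed

  have "finite I" "finite E" "card E < card I"
    using card by (auto simp: I_def E_def mult_ac)
  from nontrivial_kernel[OF this, of "\<lambda>\<iota> (s, l). coeff (coeff (v \<iota>) s) l"]
  obtain u where u: "\<exists>\<iota>\<in>I. u \<iota> \<noteq> 0"
    and u0: "\<And>s l. (s, l) \<in> E \<Longrightarrow> (\<Sum>\<iota>\<in>I. u \<iota> * coeff (coeff (v \<iota>) s) l) = 0"
    by (metis (mono_tags, lifting) case_prod_conv sum.cong)
  define V where "V = (\<Sum>\<iota>\<in>I. [:[:u \<iota>:]:] * v \<iota>)"
  define \<Phi> where "\<Phi> = (\<Sum>\<iota>\<in>I. smult (u \<iota>) (P \<iota>))"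

  have V0: "coeff (coeff V s) l = 0" if "l < M" for s l
  proof (cases "s < A + B + n * M")
    case True
    thus ?thesis using u0[of s l] that by (simp add: E_def V_def coeff_sum)
  next
    case False
    have "coeff (coeff (v \<iota>) s) l = 0" if "\<iota> \<in> I" for \<iota>
    proof (rule ccontr)
      assume *: "coeff (coeff (v \<iota>) s) l \<noteq> 0"
      obtain j k m where \<iota>: "\<iota> = (j, k, m)" "k < B" "m < A" using \<open>\<iota> \<in> I\<close> by (auto simp: I_def)
      have "s \<le> m + k + n * l" using wdeg_v * unfolding \<iota> wdeg_le_def by blast
      also have "n * l \<le> n * M" using \<open>l < M\<close> by simp
      finally show False using False \<iota> by linarith
    qed
    thus ?thesis by (simp add: V_def coeff_sum)
  qed

  \<comment> \<open>The \<open>P \<iota>\<close> have pairwise distinct orders of vanishing at \<open>x0\<close>.\<close>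
  have "\<Phi> \<noteq> 0"
  proof -
    define Q where "Q = (\<lambda>(j, k :: nat, m :: nat). (\<Prod>i\<in>{..<n} - {i0}. [:t i, 1:] ^ e i) ^ j)"
    define ord where "ord = (\<lambda>(j, k, m). m + q * k + e i0 * j)"
    have "P \<iota> = [:-x0, 1:] ^ ord \<iota> * Q \<iota>" for \<iota>
    proof -
      obtain j k m where \<iota>: "\<iota> = (j, k, m)" by (cases \<iota>)
      have "g = [:-x0, 1:] ^ e i0 * (\<Prod>i\<in>{..<n} - {i0}. [:t i, 1:] ^ e i)"
        unfolding g_def x0_def using i0 by (subst prod.remove[of _ i0]) auto
      thus ?thesis
        by (simp add: P_def Q_def ord_def \<iota> power_mult_distrib power_add mult_ac flip: power_mult)
    qed
    moreover have "poly (Q \<iota>) x0 \<noteq> 0" for \<iota>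
    proof -
      have "t i \<noteq> t i0" if "i < n" "i \<noteq> i0" for i
        using inj i0 that by (auto simp: inj_on_def)
      thus ?thesis
        by (auto simp: Q_def poly_prod x0_def split: prod.splits)
    qed
    moreover have "inj_on ord I"
    proof -
      \<comment> \<open>The order is read as digits: \<open>k\<close> counts multiples of
        \<open>q\<close>; below \<open>q\<close>, \<open>j\<close> counts multiples of
        \<open>e i0\<close>, with remainder \<open>m < A \<le> e i0\<close>.\<close>
      have lt: "m + e i0 * j < q" if "j < d" "m < A" for j m
      proof -
        have "m + e i0 * j < e i0 * Suc j" using that A by simp
        also have "\<dots> \<le> e i0 * d" using that by (intro mult_le_mono) auto
        finally show ?thesis using e by (simp add: mult.commute)
      qed
      have inj: "j = j' \<and> k = k' \<and> m = m'"
        if *: "j < d" "m < A" "j' < d" "m' < A" "m + q * k + e i0 * j = m' + q * k' + e i0 * j'"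
        for j k m j' k' m'
      proof -
        have "k = (m + e i0 * j + q * k) div q" "k' = (m' + e i0 * j' + q * k') div q"
          using lt[OF *(1,2)] lt[OF *(3,4)] by simp_all
        hence k: "k = k'" using *(5) by (simp add: ac_simps)
        hence eq: "m + e i0 * j = m' + e i0 * j'" using *(5) by simp
        have "j = (m + e i0 * j) div e i0" using *(2) A by simp
        also have "\<dots> = j'" unfolding eq using *(4) A by simp
        finally show ?thesis using k eq by simp
      qed
      show ?thesis
      proof (rule inj_onI)
        fix \<iota> \<iota>' assume *: "\<iota> \<in> I" "\<iota>' \<in> I" "ord \<iota> = ord \<iota>'"
        obtain j k m j' k' m' where \<iota>: "\<iota> = (j, k, m)" "\<iota>' = (j', k', m')"
          by (cases \<iota>, cases \<iota>')
        show "\<iota> = \<iota>'" using inj[of j m j' m' k k'] * by (simp add: \<iota> I_def ord_def)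
      qed
    qed
    ultimately show ?thesis
      unfolding \<Phi>_def using sum_distinct_orders_nonzero[of I ord Q x0 u] u \<open>finite I\<close> by simp
  qed

  have deg: "degree \<Phi> \<le> A + q * (B - 1) + (d - 1) * (\<Sum>i<n. e i)"
    unfolding \<Phi>_def
  proof (intro degree_sum_le \<open>finite I\<close> order_trans[OF degree_smult_le])
    fix \<iota> assume "\<iota> \<in> I"
    then obtain j k m where \<iota>: "\<iota> = (j, k, m)" "j \<le> d - 1" "k \<le> B - 1" "m \<le> A"
      by (auto simp: I_def)
    have "degree g \<le> (\<Sum>i<n. e i)"
      unfolding g_def by (rule order_trans[OF degree_prod_sum_le]) (auto simp: degree_linear_power)
    hence g: "degree (g ^ j) \<le> (d - 1) * (\<Sum>i<n. e i)"
      using order_trans[OF degree_power_le mult_le_mono[OF _ \<iota>(2)]] by (metis mult.commute)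
    have "degree (P \<iota>) \<le> m + q * k + degree (g ^ j)"
      unfolding P_def \<iota> prod.case
      by (rule order_trans[OF degree_mult_le]) (simp add: degree_linear_power)
    also have "\<dots> \<le> A + q * (B - 1) + (d - 1) * (\<Sum>i<n. e i)"
      using \<iota> g by (intro add_mono mult_le_mono) auto
    finally show "degree (P \<iota>) \<le> A + q * (B - 1) + (d - 1) * (\<Sum>i<n. e i)" .
  qed

  have "[:-b, 1:] ^ M dvd \<Phi>" if b: "b \<in> S" for b
  proof -
    define W where "W = (\<Prod>i<n. b + t i)"
    have W: "W \<noteq> 0" using S(2)[OF b] by (simp add: W_def)
    \<comment> \<open>Composition with \<open>L\<close> substitutes \<open>b + W * U\<close> for
      \<open>X\<close>. As \<open>W\<close> is nonzero this can be undone, so vanishing to order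
      \<open>M\<close> at \<open>b\<close> becomes divisibility by \<open>U ^ M\<close>.\<close>
    define L where "L = [:b, W:]"
    have poly_w: "poly w [:b:] = [:W:]"
      by (simp add: w_def W_def poly_prod add.commute prod_to_poly)
    have poly_w': "poly (w' i) [:b:] = [:W / (b + t i):]" if "i < n" for i
      using S(2)[OF b that] that
      by (simp add: w'_def W_def poly_prod add.commute prod_to_poly prod.remove[of "{..<n}" i])
    have dvd: "monom 1 M dvd pcompose (P \<iota>) L - poly (v \<iota>) [:b:]" for \<iota>
    proof -
      obtain j k m where \<iota>: "\<iota> = (j, k, m)" by (cases \<iota>)
      define C where "C = [:\<zeta> ^ j:] * [:b - x0, W:] ^ m * (\<Prod>i<n. [:1, W / (b + t i):] ^ e i) ^ j"
      have "pcompose g L = (\<Prod>i<n. [:b + t i, W:] ^ e i)"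
        by (simp add: g_def L_def pcompose_prod pcompose_power pcompose_pCons add.commute)
      also have "\<dots> = (\<Prod>i<n. [:(b + t i) ^ e i:] * [:1, W / (b + t i):] ^ e i)"
        using S(2)[OF b] by (intro prod.cong refl) (simp add: poly_const_pow flip: power_mult_distrib smult_power)
      also have "\<dots> = [:\<zeta>:] * (\<Prod>i<n. [:1, W / (b + t i):] ^ e i)"
        using S(3)[OF b] by (simp add: prod.distrib prod_to_poly del: mult_pCons_left)
      finally have "pcompose (P \<iota>) L =
          [:b - x0, W:] ^ m * ([:b - x0, W:] ^ q) ^ k * ([:\<zeta>:] * (\<Prod>i<n. [:1, W / (b + t i):] ^ e i)) ^ j"
        by (simp add: \<iota> P_def pcompose_mult pcompose_power L_def pcompose_pCons power_add power_mult
            del: mult_pCons_left)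
      also have "\<dots> = C * ([:b - x0, W:] ^ q) ^ k"
        by (simp add: C_def power_mult_distrib mult_ac poly_const_pow del: mult_pCons_left)
      finally have 1: "pcompose (P \<iota>) L = C * ([:b - x0, W:] ^ q) ^ k" .
      have xq: "b - x0 ^ q = (b - x0) ^ q"
        using freshmans_dream'[of q r "b - x0" x0] q S(1)[OF b] by (simp add: diff_eq_eq)
      have "poly (\<Prod>i<n. (1 + w' i * U) ^ e i) [:b:] = (\<Prod>i<n. [:1, W / (b + t i):] ^ e i)"
        unfolding poly_prod by (intro prod.cong refl) (simp add: poly_w' U_def one_pCons)
      hence "poly (v \<iota>) [:b:] = C * [:b - x0 ^ q:] ^ k"
        by (simp add: \<iota> v_def C_def poly_w U_def mult_ac del: mult_pCons_left)
      hence 2: "pcompose (P \<iota>) L - poly (v \<iota>) [:b:] = C * (([:b - x0, W:] ^ q) ^ k - [:b - x0 ^ q:] ^ k)"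
        using 1 by (simp add: right_diff_distrib)
      \<comment> \<open>Frobenius makes \<open>[:b - x0, W:] ^ q\<close> a constant plus a multiple
        of \<open>U ^ q\<close>; only the constant enters \<open>v\<close>.\<close>
      have "monom 1 M dvd monom (W ^ q) q"
        using M by (auto simp: monom_1_dvd_iff')
      also have "monom (W ^ q) q = [:b - x0, W:] ^ q - [:b - x0 ^ q:]"
        by (simp add: poly_power_q_linear[OF q] xq)
      also have "\<dots> dvd ([:b - x0, W:] ^ q) ^ k - [:b - x0 ^ q:] ^ k"
        by (metis dvd_triv_left power_diff_sumr2)
      finally show ?thesis unfolding 2 by simp
    qed
    have "monom 1 M dvd pcompose \<Phi> L - poly V [:b:]"
    proof -
      have "pcompose \<Phi> L - poly V [:b:] = (\<Sum>\<iota>\<in>I. smult (u \<iota>) (pcompose (P \<iota>) L - poly (v \<iota>) [:b:]))"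
        by (simp add: \<Phi>_def V_def pcompose_sum pcompose_smult poly_sum sum_subtractf smult_diff_right)
      thus ?thesis using dvd by (auto intro!: dvd_sum dvd_smult)
    qed
    moreover have "monom 1 M dvd poly V [:b:]"
    proof -
      have "monom 1 M dvd coeff V s" for s
        using V0 by (auto simp: monom_1_dvd_iff')
      thus ?thesis unfolding poly_altdef by (intro dvd_sum dvd_mult2)
    qed
    ultimately have "monom 1 M dvd pcompose \<Phi> L"
      by (metis diff_add_cancel dvd_add)
    then obtain R where "pcompose \<Phi> L = [:0, 1:] ^ M * R"
      by (auto simp: dvd_def monom_altdef)
    hence "pcompose (pcompose \<Phi> L) [:- b / W, 1 / W:] =
        smult ((1 / W) ^ M) ([:-b, 1:] ^ M) * pcompose R [:- b / W, 1 / W:]"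
      by (simp add: pcompose_mult pcompose_power pcompose_pCons flip: smult_power)
    moreover have "pcompose (pcompose \<Phi> L) [:- b / W, 1 / W:] = \<Phi>"
      using W by (simp add: pcompose_assoc[symmetric] L_def pcompose_pCons)
    ultimately show ?thesis by (metis dvd_triv_left mult_smult_left mult_smult_right)
  qed
  from multiple_roots_bound[OF \<open>\<Phi> \<noteq> 0\<close> _ this] have "M * card S \<le> degree \<Phi>" by simp
  with deg show ?thesis by linarith
qed

section \<open>The sieve\<close>

lemma sum_digits: "(\<Sum>i<n. (m div q ^ i mod q) * q ^ i) = m mod q ^ n" for m q :: nat
proof (induction n)
  case (Suc n)
  have "m mod q ^ Suc n = q ^ n * (m div q ^ n mod q) + m mod q ^ n"
    unfolding power_Suc2 by (rule mod_mult2_eq)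
  thus ?case using Suc by (simp del: power_Suc)
qed simp

lemma prod_primes_dvd_iff:
  fixes S :: "nat set"
  assumes "finite S" "\<And>l. l \<in> S \<Longrightarrow> prime l"
  shows "\<Prod>S dvd m \<longleftrightarrow> (\<forall>l\<in>S. l dvd m)"
  using assms
proof (induction S rule: finite_induct)
  case (insert l S)
  have "coprime l (\<Prod>S)"
    using insert.hyps insert.prems by (intro prod_coprime_right) (metis insertCI primes_coprime)
  thus ?case using insert by (auto intro: divides_mult dest: dvd_mult_left dvd_mult_right)
qed simp

text \<open>Let \<open>w = card (prime_factors N)\<close>. If every \<open>ind b\<close> shared a
  prime with \<open>N\<close>, the alternating sum over sets of primes would vanish. Its main term
  is at least \<open>card X / 2 ^ w\<close>, as each factor \<open>1 - 1 / l\<close> is at least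
  \<open>1 / 2\<close>, and its \<open>2 ^ w\<close> errors are at most \<open>E\<close> each; hence
  the factor \<open>4 ^ w\<close>.\<close>

lemma sieve_exists_coprime:
  fixes ind :: "'b \<Rightarrow> nat" and N :: nat and E :: real
  assumes X: "finite X" and N: "N > 0"
    and E: "\<And>d. d dvd N \<Longrightarrow> \<bar>real (card {b \<in> X. d dvd ind b}) - real (card X) / real d\<bar> \<le> E"
    and small: "4 ^ card (prime_factors N) * E < card X"
  shows "\<exists>b\<in>X. coprime (ind b) N"
proof (rule ccontr)
  assume contra: "\<not> ?thesis"
  have not_coprime: "\<exists>l\<in>prime_factors N. l dvd ind b" if "b \<in> X" for b
  proof -
    have "gcd (ind b) N \<noteq> 1" using contra that by (auto simp: coprime_iff_gcd_eq_1)
    then obtain l where "prime l" "l dvd gcd (ind b) N" using prime_factor_nat by blast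
    thus ?thesis using N by (auto simp: in_prime_factors_iff)
  qed
  define P where "P = prime_factors N"
  have P: "finite P" "\<And>l. l \<in> P \<Longrightarrow> prime l" by (auto simp: P_def)
  have prod_dvd: "\<Prod>S dvd m \<longleftrightarrow> (\<forall>l\<in>S. l dvd m)" if "S \<in> Pow P" for S m
    using that P by (intro prod_primes_dvd_iff) (auto intro: finite_subset)
  have fin: "finite S" if "S \<in> Pow P" for S using that P(1) by (auto intro: finite_subset)
  define c where "c = (\<lambda>S. real (card {b \<in> X. \<Prod>S dvd ind b}))"
  have "(\<Sum>S\<in>Pow P. (-1) ^ card S * c S) = 0"
  proof -
    have "(\<Sum>S\<in>Pow P. (-1) ^ card S * c S)
        = (\<Sum>S\<in>Pow P. \<Sum>b\<in>X. (-1) ^ card S * of_bool (\<Prod>S dvd ind b))"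
      using X by (simp add: c_def sum_distrib_left[symmetric] Int_def)
    also have "\<dots> = (\<Sum>b\<in>X. \<Sum>S\<in>Pow P. (-1) ^ card S * of_bool (\<Prod>S dvd ind b))"
      by (rule sum.swap)
    \<comment> \<open>For fixed \<open>b\<close> the sum is an expanded product over the primes
      \<open>l\<close>, with a zero factor as soon as one \<open>l\<close> divides
      \<open>ind b\<close>.\<close>
    also have "\<dots> = (\<Sum>b\<in>X. \<Prod>l\<in>P. (- of_bool (l dvd ind b)) + 1)"
    proof (intro sum.cong refl)
      fix b
      have "(\<Prod>l\<in>S. - of_bool (l dvd ind b)) = (-1) ^ card S * (of_bool (\<Prod>S dvd ind b) :: real)"
        if "S \<in> Pow P" for S
        using fin[OF that] by (auto simp: prod_dvd[OF that] prod_uminus)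
      thus "(\<Sum>S\<in>Pow P. (-1) ^ card S * of_bool (\<Prod>S dvd ind b))
          = (\<Prod>l\<in>P. (- of_bool (l dvd ind b)) + (1 :: real))"
        unfolding prod_add[OF P(1)] by (intro sum.cong) auto
    qed
    also have "\<dots> = 0"
    proof (intro sum.neutral ballI)
      fix b assume "b \<in> X"
      thus "(\<Prod>l\<in>P. (- of_bool (l dvd ind b)) + (1 :: real)) = 0"
        using not_coprime P(1) by (auto simp: P_def)
    qed
    finally show ?thesis .
  qed
  moreover have "(\<Prod>l\<in>P. - (1 / real l) + 1) = (\<Sum>S\<in>Pow P. (-1) ^ card S / real (\<Prod>S))"
    unfolding prod_add[OF P(1)] by (intro sum.cong) (auto simp: prod_dividef prod_uminus fin)
  ultimately have "card X * (\<Prod>l\<in>P. - (1 / real l) + 1)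
      = (\<Sum>S\<in>Pow P. (-1) ^ card S * (card X / real (\<Prod>S) - c S))"
    by (simp add: sum_distrib_left right_diff_distrib sum_subtractf mult_ac)
  also have "\<dots> \<le> (\<Sum>S\<in>Pow P. E)"
  proof (intro sum_mono)
    fix S assume S: "S \<in> Pow P"
    have S_dvd: "\<Prod>S dvd N" using S by (subst prod_dvd) (auto simp: P_def)
    hence "\<bar>card X / real (\<Prod>S) - c S\<bar> \<le> E" using E[OF S_dvd] by (simp add: c_def abs_minus_commute)
    thus "(-1) ^ card S * (card X / real (\<Prod>S) - c S) \<le> E"
      by (cases "even (card S)") auto
  qed
  also have "\<dots> = 2 ^ card P * E" by (simp add: card_Pow P(1))
  finally have upper: "card X * (\<Prod>l\<in>P. - (1 / real l) + 1) \<le> 2 ^ card P * E" .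
  have "(1 / 2) ^ card P = (\<Prod>l\<in>P. 1 / 2 :: real)" by simp
  also have "\<dots> \<le> (\<Prod>l\<in>P. - (1 / real l) + 1)"
  proof (intro prod_mono conjI)
    fix l assume "l \<in> P"
    hence "2 \<le> l" using P(2) prime_ge_2_nat by blast
    thus "1 / 2 \<le> - (1 / real l) + 1" by (simp add: field_simps)
  qed simp
  finally have "card X * (1 / 2) ^ card P \<le> card X * (\<Prod>l\<in>P. - (1 / real l) + 1)"
    by (rule mult_left_mono) simp
  with upper have "card X * (1 / 2) ^ card P \<le> 2 ^ card P * E" by linarith
  hence "2 ^ card P * (card X * (1 / 2) ^ card P) \<le> 2 ^ card P * (2 ^ card P * E)"
    by (rule mult_left_mono) simp
  moreover have "2 ^ card P * (card X * (1 / 2 :: real) ^ card P) = card X"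
    by (simp add: power_divide)
  moreover have "2 ^ card P * (2 ^ card P * E) = 4 ^ card P * E"
    using power_mult_distrib[of "2 :: real" 2 "card P"] by simp
  ultimately have "card X \<le> 4 ^ card P * E" by (simp only:)
  thus False using small unfolding P_def by linarith
qed

text \<open>Primes \<open>l\<close> above \<open>4 powr (1 / \<delta>)\<close> satisfy
  \<open>4 \<le> l powr \<delta>\<close>, and the product of those dividing \<open>N\<close> is at
  most \<open>N\<close>. The number of smaller ones is bounded in terms of \<open>\<delta>\<close>
  alone, which gives \<open>C\<close>.\<close>

lemma four_power_card_prime_factors_bound:
  fixes \<delta> :: real
  assumes "\<delta> > 0"
  shows "\<exists>C\<ge>1. \<forall>N>0. 4 ^ card (prime_factors N) \<le> C * real N powr \<delta>"
proof -
  define k where "k = nat \<lfloor>4 powr (1 / \<delta>)\<rfloor>"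
  have "4 ^ card (prime_factors N) \<le> 4 ^ Suc k * real N powr \<delta>" if N: "N > 0" for N :: nat
  proof -
    define P where "P = prime_factors N"
    define S where "S = P \<inter> {..k}"
    define L where "L = P - {..k}"
    have "card P = card S + card L"
      unfolding S_def L_def P_def by (metis card_Diff_subset_Int card_mono finite_Int finite_set_mset inf.cobounded1 le_add_diff_inverse)
    moreover have "card S \<le> card {..k}" unfolding S_def by (intro card_mono) auto
    moreover have "(4 :: real) ^ card L \<le> real N powr \<delta>"
    proof -
      have "4 \<le> real l powr \<delta>" if "l \<in> L" for l
      proof -
        have "k < l" using that by (simp add: L_def)
        hence "\<lfloor>4 powr (1 / \<delta>)\<rfloor> < int l" by (simp add: k_def nat_less_iff)
        hence "4 powr (1 / \<delta>) < real l" by (simp add: floor_less_iff)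
        hence "(4 powr (1 / \<delta>)) powr \<delta> \<le> real l powr \<delta>" using assms by (intro powr_mono2) auto
        thus ?thesis using assms by (simp add: powr_powr)
      qed
      hence "(\<Prod>l\<in>L. 4) \<le> (\<Prod>l\<in>L. real l powr \<delta>)" by (intro prod_mono) auto
      also have "\<dots> = real (\<Prod>L) powr \<delta>" by (simp add: prod_powr_distrib)
      also have "\<dots> \<le> real N powr \<delta>"
      proof -
        have "\<Prod>L dvd \<Prod>P" unfolding L_def P_def by (intro prod_dvd_prod_subset) auto
        also have "\<Prod>P dvd N" unfolding P_def using N
          by (subst prod_primes_dvd_iff) auto
        finally have "\<Prod>L \<le> N" using N by (rule dvd_imp_le)
        thus ?thesis using assms by (intro powr_mono2 of_nat_mono of_nat_0_le_iff) auto
      qed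
      finally show ?thesis by simp
    qed
    ultimately have "(4 :: real) ^ card P \<le> 4 ^ Suc k * real N powr \<delta>"
      unfolding power_add \<open>card P = card S + card L\<close>
      by (intro mult_mono power_increasing) auto
    thus ?thesis by (simp add: P_def)
  qed
  moreover have "1 \<le> (4 :: real) ^ Suc k" by (rule one_le_power) simp
  ultimately show ?thesis by blast
qed

section \<open>Extensions of degree \<open>p\<close> in characteristic \<open>p\<close>\<close>

text \<open>The subfield of order \<open>q\<close> appears as the set of fixed points of
  \<open>x ^ q\<close>, so that no second type is needed. The degree and the characteristic are the
  same \<open>p\<close>.\<close>

locale finite_field_extension =
  fixes g :: "'a :: finite_field" and p q r :: nat
  assumes p_def: "p = CHAR('a)" and q_def: "q = p ^ r" and r_pos: "r > 0"
    and card_UNIV: "card (UNIV :: 'a set) = q ^ p"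
    and card_fixed: "card {b :: 'a. b ^ q = b} = q"
    and g_nonzero: "g \<noteq> 0" and gen: "\<And>x. x \<noteq> 0 \<Longrightarrow> \<exists>i. x = g ^ i"
begin

definition K :: "'a set" where "K = {b. b ^ q = b}"

lemma prime_p: "prime p"
  by (simp add: p_def)

lemma p_ge_2: "p \<ge> 2" using prime_p by (rule prime_ge_2_nat)

lemma q_ge_2: "q \<ge> 2"
proof -
  have "2 \<le> p ^ 1" using p_ge_2 by simp
  also have "\<dots> \<le> p ^ r" using p_ge_2 r_pos by (intro power_increasing) auto
  finally show ?thesis by (simp add: q_def)
qed

lemma frobenius_add: "(x + y :: 'a) ^ (q ^ i) = x ^ (q ^ i) + y ^ (q ^ i)"
  by (rule freshmans_dream'[of _ "r * i"]) (simp_all add: p_def q_def power_mult)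

lemma frobenius_add': "(x + y :: 'a) ^ q = x ^ q + y ^ q"
  using frobenius_add[of x y 1] by simp

lemma frobenius_fixed: "(x :: 'a) ^ q ^ d = x \<Longrightarrow> x ^ q ^ (d * u) = x"
proof (induction u)
  case (Suc u)
  have "x ^ q ^ (d * Suc u) = (x ^ q ^ d) ^ q ^ (d * u)"
    by (simp add: power_add power_mult)
  thus ?case using Suc by simp
qed simp

lemma K_frobenius: "b \<in> K \<Longrightarrow> b ^ q ^ i = b"
  using frobenius_fixed[of b 1 i] by (simp add: K_def)

lemma frobenius_p: "(x :: 'a) ^ q ^ p = x"
  using finite_field_power_card_eq_same[of x] by (simp add: card_UNIV)

lemma K_uminus: "b \<in> K \<Longrightarrow> - b \<in> K"
  using minus_unique[of b "(- b) ^ q"] frobenius_add'[of b "- b"] q_ge_2 by (simp add: K_def power_0_left)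

lemma frobenius_diff: "(x - y :: 'a) ^ (q ^ i) = x ^ (q ^ i) - y ^ (q ^ i)"
  using frobenius_add[of "x - y" y i] by (simp add: eq_diff_eq)

lemma g_power_order: "g ^ (q ^ p - 1) = 1"
proof -
  have "Suc (q ^ p - 1) = q ^ p" using q_ge_2 by simp
  hence "g * g ^ (q ^ p - 1) = g" using frobenius_p[of g] by (metis power_Suc)
  thus ?thesis using g_nonzero by simp
qed

text \<open>The powers of \<open>g\<close> with exponent below \<open>q ^ p - 1\<close> already
  reach all \<open>q ^ p - 1\<close> nonzero elements, so they are distinct.\<close>

lemma g_power_eq_1_iff: "g ^ i = 1 \<longleftrightarrow> q ^ p - 1 dvd i"
proof
  define Q where "Q = q ^ p - 1"
  have "q ^ 1 \<le> q ^ p" using q_ge_2 p_ge_2 by (intro power_increasing) auto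
  hence Q: "Q > 0" using q_ge_2 by (simp add: Q_def)
  have mod: "g ^ i = g ^ (i mod Q)" for i
  proof -
    have "g ^ i = (g ^ Q) ^ (i div Q) * g ^ (i mod Q)" by (simp flip: power_mult power_add)
    thus ?thesis using g_power_order by (simp add: Q_def)
  qed
  have "UNIV - {0} \<subseteq> (\<lambda>i. g ^ i) ` {..<Q}"
  proof
    fix x :: 'a assume "x \<in> UNIV - {0}"
    then obtain i where "x = g ^ i" using gen by auto
    thus "x \<in> (\<lambda>i. g ^ i) ` {..<Q}" using mod[of i] Q by (intro image_eqI[of _ _ "i mod Q"]) auto
  qed
  hence "card (UNIV - {0 :: 'a}) \<le> card ((\<lambda>i. g ^ i) ` {..<Q})" by (intro card_mono) auto
  hence "card {..<Q} \<le> card ((\<lambda>i. g ^ i) ` {..<Q})"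
    by (simp add: card_Diff_singleton card_UNIV Q_def)
  hence inj: "inj_on (\<lambda>i. g ^ i) {..<Q}"
    by (intro eq_card_imp_inj_on) (auto intro: antisym card_image_le[of "{..<Q}", simplified])
  assume "g ^ i = 1"
  hence "g ^ (i mod Q) = g ^ 0" using mod[of i] by simp
  hence "i mod Q = 0" using inj Q by (auto dest: inj_onD[of _ _ "i mod Q" 0])
  thus "q ^ p - 1 dvd i" by (simp add: Q_def mod_eq_0_iff_dvd)
next
  assume "q ^ p - 1 dvd i"
  then obtain k where "i = (q ^ p - 1) * k" ..
  thus "g ^ i = 1" by (simp only: power_mult g_power_order power_one)
qed

text \<open>The exponent of the norm to \<open>K\<close>, which is also the index of the nonzero
  elements of \<open>K\<close> in the multiplicative group.\<close>

definition N :: nat where "N = (\<Sum>i<p. q ^ i)"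

lemma N_mult: "N * (q - 1) = q ^ p - 1"
  unfolding N_def using power_diff_1_eq[of "int q" p] q_ge_2
  by (simp add: mult.commute of_nat_diff flip: of_nat_eq_iff[where ?'a = int])

lemma N_pos: "N > 0"
  using p_ge_2 by (auto simp: N_def intro!: sum_pos2[of _ 0])

lemma N_le: "N \<le> 2 * q ^ (p - 1)"
proof -
  have "N * (q - 1) \<le> q * q ^ (p - 1)"
    unfolding N_mult using power_Suc[of q "p - 1"] p_ge_2 by (simp del: power_Suc)
  also have "\<dots> \<le> (2 * (q - 1)) * q ^ (p - 1)" using q_ge_2 by (intro mult_le_mono) auto
  also have "\<dots> = 2 * q ^ (p - 1) * (q - 1)" by simp
  finally show ?thesis using q_ge_2 by simp
qed

lemma N_le': "N \<le> q ^ p"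
proof -
  have "N * 1 \<le> N * (q - 1)" using q_ge_2 by (intro mult_le_mono2) simp
  thus ?thesis unfolding N_mult by simp
qed

text \<open>Modulo a common prime factor \<open>l\<close> all powers of \<open>q\<close> are
  \<open>1\<close>, so \<open>N\<close> is congruent to its number \<open>p\<close> of summands.
  Then \<open>l = p\<close>, which divides \<open>q\<close> and not \<open>q - 1\<close>.\<close>

lemma coprime_N: "coprime N (q - 1)"
proof (rule ccontr)
  assume "\<not> coprime N (q - 1)"
  then obtain l where l: "prime l" "l dvd N" "l dvd q - 1"
    using prime_factor_nat[of "gcd N (q - 1)"] by (auto simp: coprime_iff_gcd_eq_1)
  have "int l dvd int q ^ i - 1" for i
  proof -
    have "int l dvd int q - 1" using l(3) q_ge_2 by (simp add: of_nat_diff flip: int_dvd_int_iff)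
    thus ?thesis using power_diff_1_eq[of "int q" i] by simp
  qed
  hence "int l dvd (\<Sum>i<p. int q ^ i - 1)" by (intro dvd_sum)
  also have "(\<Sum>i<p. int q ^ i - 1) = int N - int p" by (simp add: N_def sum_subtractf)
  finally have "int l dvd int p" using l(2) by (metis dvd_diff_right_iff int_dvd_int_iff)
  hence "l = p" using l(1) prime_p by (simp add: primes_dvd_imp_eq)
  hence "l dvd q" using r_pos by (simp add: q_def)
  hence "l dvd q - (q - 1)" using l(3) by (rule dvd_diff_nat)
  thus False using l(1) q_ge_2 by simp
qed

section \<open>The nilpotent operator \<open>D\<close>\<close>

definition D :: "'a \<Rightarrow> 'a" where "D x = x ^ q - x"

lemma D_add: "D (x + y) = D x + D y"
  by (simp add: D_def frobenius_add')

lemma D_mult: "c \<in> K \<Longrightarrow> D (c * x) = c * D x"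
  by (simp add: D_def K_def power_mult_distrib right_diff_distrib)

lemma D_eq_0_iff: "D x = 0 \<longleftrightarrow> x \<in> K"
  by (simp add: D_def K_def)

lemma D_0: "D 0 = 0"
  using q_ge_2 by (simp add: D_def)

lemma D_power_0: "(D ^^ i) 0 = 0"
  by (induction i) (simp_all add: D_0)

lemma D_power_add: "(D ^^ i) (x + y) = (D ^^ i) x + (D ^^ i) y"
  by (induction i) (simp_all add: D_add)

lemma D_power_mult: "c \<in> K \<Longrightarrow> (D ^^ i) (c * x) = c * (D ^^ i) x"
  by (induction i) (simp_all add: D_mult)

lemma D_power_K: "c \<in> K \<Longrightarrow> i > 0 \<Longrightarrow> (D ^^ i) c = 0"
  using D_eq_0_iff[of c] by (cases i) (simp_all add: funpow_Suc_right D_power_0 del: funpow.simps)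

text \<open>\<open>D\<close> is Frobenius minus the identity, so \<open>D ^^ j\<close> is the
  polynomial \<open>[:-1, 1:] ^ j\<close> evaluated at Frobenius.\<close>

lemma D_power_eq: "(D ^^ j) x = (\<Sum>i<Suc j. Polynomial.coeff ([:-1, 1:] ^ j) i * x ^ q ^ i)"
proof (induction j arbitrary: x)
  case (Suc j)
  define f :: "'a poly" where "f = [:-1, 1:] ^ j"
  have 0: "Polynomial.coeff f (Suc j) = 0"
    unfolding f_def by (rule coeff_eq_0) (simp add: degree_linear_power)
  have "(D ^^ Suc j) x = (D ^^ j) (D x)" by (simp add: funpow_Suc_right del: funpow.simps)
  also have "\<dots> = (\<Sum>i<Suc j. Polynomial.coeff f i * (x ^ q ^ Suc i - x ^ q ^ i))"
    unfolding Suc by (simp add: D_def f_def frobenius_diff power_mult)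
  also have "\<dots> = (\<Sum>i<Suc j. Polynomial.coeff f i * x ^ q ^ Suc i) - (\<Sum>i<Suc (Suc j). Polynomial.coeff f i * x ^ q ^ i)"
    unfolding right_diff_distrib sum_subtractf using 0 by (simp only: sum.lessThan_Suc[of _ "Suc j"]) simp
  also have "(\<Sum>i<Suc j. Polynomial.coeff f i * x ^ q ^ Suc i) =
      (\<Sum>i<Suc (Suc j). Polynomial.coeff (pCons 0 f) i * x ^ q ^ i)"
    by (simp only: sum.lessThan_Suc_shift[of _ "Suc j"] coeff_pCons_Suc) simp
  finally show ?case
    by (simp only: f_def power_Suc mult_pCons_left smult_minus_left smult_1_left coeff_add coeff_minus
        left_diff_distrib sum_subtractf distrib_right) (simp add: sum_negf sum.distrib sum_subtractf algebra_simps)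
qed simp

text \<open>In characteristic \<open>p\<close> the polynomial \<open>[:-1, 1:] ^ p\<close> has only
  its outer terms, and the \<open>p\<close>-th iterate of Frobenius is the identity.\<close>

lemma D_power_p: "(D ^^ p) x = 0"
proof -
  have "(-1 :: 'a) ^ p = - 1"
    using freshmans_dream[of p "1 :: 'a" "-1"] prime_gt_0_nat[of p]
    by (simp add: p_def power_0_left eq_neg_iff_add_eq_0 add.commute)
  hence f: "[:-1 :: 'a, 1:] ^ p = [:-1:] + Polynomial.monom 1 p"
    using poly_power_q_linear[of p 1 "-1 :: 'a" 1] by (simp add: p_def)
  have "p > 0" using prime_gt_0_nat[of p] by (simp add: p_def)
  have "(D ^^ p) x = (\<Sum>i<Suc p. ((if i = 0 then -1 else 0) + (if i = p then 1 else 0)) * x ^ q ^ i)"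
    unfolding D_power_eq f using \<open>p > 0\<close> by (intro sum.cong refl) (auto simp: coeff_pCons split: nat.splits)
  also have "\<dots> = x ^ q ^ p - x"
    unfolding distrib_right sum.distrib
    by (simp add: if_distrib[of "\<lambda>c. c * _"] sum.delta cong: if_cong)
  finally show ?thesis using finite_field_power_card_eq_same[of x] by (simp add: card_UNIV)
qed

text \<open>\<open>D\<close> maps the kernel of \<open>D ^^ Suc j\<close> into that of
  \<open>D ^^ j\<close>, and each nonempty fibre of \<open>D\<close> lies in a coset of
  \<open>K\<close>.\<close>

lemma card_D_kernel_le: "card {x. (D ^^ j) x = 0} \<le> q ^ j"
proof (induction j)
  case (Suc j)
  have fibre: "card {x. D x = y} \<le> q" for y
  proof (cases "\<exists>x0. D x0 = y")
    case True
    then obtain x0 where x0: "D x0 = y" ..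
    have "{x. D x = y} \<subseteq> (\<lambda>c. x0 + c) ` K"
    proof
      fix x assume "x \<in> {x. D x = y}"
      hence "D (x - x0) = 0" using D_add[of "x - x0" x0] x0 by simp
      thus "x \<in> (\<lambda>c. x0 + c) ` K" by (intro image_eqI[of _ _ "x - x0"]) (auto simp: D_eq_0_iff)
    qed
    hence "card {x. D x = y} \<le> card ((\<lambda>c. x0 + c) ` K)" by (intro card_mono) auto
    also have "\<dots> \<le> card K" by (rule card_image_le) simp
    finally show ?thesis using card_fixed by (simp add: K_def)
  qed simp
  have "{x. (D ^^ Suc j) x = 0} = (\<Union>y\<in>{y. (D ^^ j) y = 0}. {x. D x = y})"
    by (auto simp: funpow_Suc_right simp del: funpow.simps)
  hence "card {x. (D ^^ Suc j) x = 0} \<le> (\<Sum>y\<in>{y. (D ^^ j) y = 0}. card {x. D x = y})"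
    by (simp add: card_UN_le)
  also have "\<dots> \<le> card {y. (D ^^ j) y = 0} * q"
    using sum_bounded_above[of "{y. (D ^^ j) y = 0}" "\<lambda>y. card {x. D x = y}" q] fibre by simp
  also have "\<dots> \<le> q ^ j * q" using Suc by (rule mult_le_mono1)
  finally show ?case by (simp add: mult.commute)
qed simp

lemma D_power_nonzero: "\<exists>x. (D ^^ (p - 1)) x \<noteq> 0"
proof (rule ccontr)
  assume "\<not> ?thesis"
  hence "{x. (D ^^ (p - 1)) x = 0} = UNIV" by auto
  hence "q ^ p \<le> q ^ (p - 1)" using card_D_kernel_le[of "p - 1"] by (simp add: card_UNIV)
  moreover have "q ^ (p - 1) < q ^ p"
    using q_ge_2 prime_gt_0_nat[of p] by (intro power_strict_increasing) (auto simp: p_def)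
  ultimately show False by simp
qed

end

section \<open>Powers on a line\<close>

locale finite_field_line = finite_field_extension g p q r
  for g :: "'a :: finite_field" and p q r :: nat +
  fixes \<theta> :: 'a
  assumes theta: "\<theta> ^ q \<noteq> \<theta>"
begin

section \<open>Conjugates of \<open>\<theta>\<close>\<close>

definition conjugate :: "nat \<Rightarrow> 'a" where "conjugate i = \<theta> ^ (q ^ i)"

text \<open>As \<open>p\<close> is prime, some multiple of \<open>d\<close> is \<open>1\<close>
  modulo \<open>p\<close>. So an element fixed by the \<open>d\<close>-th iterate of Frobenius is
  fixed by Frobenius itself.\<close>

lemma not_fixed_by_frobenius_power:
  assumes "0 < d" "d < p"
  shows "\<theta> ^ q ^ d \<noteq> \<theta>"
proof
  assume *: "\<theta> ^ q ^ d = \<theta>"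
  have "coprime d p" using assms prime_p
    by (metis coprime_commute dvd_imp_le leD prime_imp_coprime)
  then obtain u v where uv: "d * u = p * v + 1"
    using coprime_bezout_strong[of d p] prime_p by (metis prime_nat_iff less_irrefl)
  have "\<theta> = \<theta> ^ q ^ (d * u)" using frobenius_fixed[OF *] by simp
  also have "\<dots> = (\<theta> ^ q ^ (p * v)) ^ q" by (simp only: uv power_add power_one_right power_mult[of \<theta> "q ^ (p * v)" q])
  also have "\<dots> = \<theta> ^ q" using frobenius_fixed[OF frobenius_p] by simp
  finally show False using theta by simp
qed

lemma inj_conjugate: "inj_on conjugate {..<p}"
proof (rule linorder_inj_onI')
  fix i j assume "i \<in> {..<p}" "j \<in> {..<p}" and ij: "i < j"
  show "conjugate i \<noteq> conjugate j"
  proof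
    assume eq: "conjugate i = conjugate j"
    have "\<theta> = \<theta> ^ q ^ (i + (p - i))" using frobenius_p \<open>i \<in> {..<p}\<close> by simp
    also have "\<dots> = conjugate i ^ q ^ (p - i)" by (simp add: conjugate_def power_add power_mult)
    also have "conjugate i = conjugate j" by (rule eq)
    also have "conjugate j ^ q ^ (p - i) = \<theta> ^ q ^ (j + (p - i))" by (simp add: conjugate_def power_add power_mult)
    also have "j + (p - i) = p + (j - i)" using \<open>i \<in> {..<p}\<close> ij by simp
    also have "\<theta> ^ q ^ (p + (j - i)) = \<theta> ^ q ^ (j - i)"
      by (simp only: power_add power_mult frobenius_p)
    finally have "\<theta> ^ q ^ (j - i) = \<theta>" by simp
    thus False using not_fixed_by_frobenius_power[of "j - i"] ij \<open>j \<in> {..<p}\<close> by (simp add: less_imp_diff_less)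
  qed
qed

lemma add_conjugate: "b \<in> K \<Longrightarrow> b + conjugate i = (\<theta> + b) ^ q ^ i"
  by (simp add: conjugate_def frobenius_add K_frobenius add.commute)

lemma add_theta_nonzero: "b \<in> K \<Longrightarrow> \<theta> + b \<noteq> 0"
  using K_uminus theta by (auto simp: K_def add_eq_0_iff2)

lemma power_line:
  assumes "b \<in> K" "m < q ^ p"
  shows "(\<theta> + b) ^ m = (\<Prod>i<p. (b + conjugate i) ^ (m div q ^ i mod q))"
proof -
  have "(\<theta> + b) ^ m = (\<theta> + b) ^ (\<Sum>i<p. (m div q ^ i mod q) * q ^ i)"
    by (simp only: sum_digits mod_less[OF assms(2)])
  also have "\<dots> = (\<Prod>i<p. (\<theta> + b) ^ ((m div q ^ i mod q) * q ^ i))"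
    by (rule power_sum)
  also have "\<dots> = (\<Prod>i<p. (b + conjugate i) ^ (m div q ^ i mod q))"
    unfolding add_conjugate[OF assms(1)] by (metis mult.commute power_mult)
  finally show ?thesis .
qed

text \<open>Stepanov's bound with the top digit of \<open>m\<close> in the role of both
  \<open>e i0\<close> and \<open>A\<close>, with \<open>B = M + 1\<close> and multiplicity
  \<open>d * M\<close>. It amounts to \<open>q / d\<close> plus an error of
  \<open>(p + 1) * q / M\<close>.\<close>

lemma card_power_residue_class_le:
  assumes d: "d > 0" "d dvd q ^ p - 1" and M: "M > 0" "(p + 4) * d\<^sup>2 * M\<^sup>2 < q"
  shows "M * d * card {b \<in> K. (\<theta> + b) ^ ((q ^ p - 1) div d) = \<zeta>} \<le> q * M + d * (p + 1) * q"
proof -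
  define m where "m = (q ^ p - 1) div d"
  define e where "e = (\<lambda>i. m div q ^ i mod q)"
  define S where "S = {b \<in> K. (\<theta> + b) ^ m = \<zeta>}"
  have Q: "q ^ p > 0" using q_ge_2 by simp
  have dm: "d * m = q ^ p - 1" unfolding m_def using d(2) by (rule dvd_mult_div_cancel)
  have "1 * m \<le> d * m" using d(1) by (intro mult_le_mono) auto
  hence m_less: "m < q ^ p" using Q dm by linarith
  have qp: "q ^ p = q * q ^ (p - 1)" using power_Suc[of q "p - 1"] p_ge_2 by (simp del: power_Suc)
  \<comment> \<open>The next inequalities place the top digit between \<open>q / d - 1\<close> and
    \<open>q / d\<close>.\<close>
  have e_top: "e (p - 1) = m div q ^ (p - 1)"
    using m_less qp by (simp add: e_def less_mult_imp_div_less)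
  have "d * e (p - 1) * q ^ (p - 1) \<le> d * m"
    unfolding e_top mult.assoc by (intro mult_le_mono order_refl div_times_less_eq_dividend)
  also have "\<dots> \<le> q * q ^ (p - 1)" using dm qp by simp
  finally have e_le: "d * e (p - 1) \<le> q" using q_ge_2 by simp
  have "q * q ^ (p - 1) \<le> d * Suc m" using dm d(1) qp by simp
  moreover have "Suc m \<le> Suc (e (p - 1)) * q ^ (p - 1)"
    unfolding e_top using q_ge_2 by (simp add: dividend_less_div_times Suc_leI add.commute)
  ultimately have "q * q ^ (p - 1) \<le> d * Suc (e (p - 1)) * q ^ (p - 1)"
    unfolding mult.assoc by (meson le_trans mult_le_mono2)
  hence e_ge: "q \<le> d * Suc (e (p - 1))" by (rule mult_right_le_imp_le) (use q_ge_2 in simp)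
  have "d * ((p + 4) * d * M\<^sup>2) < d * Suc (e (p - 1))"
    using M e_ge by (simp add: power2_eq_square mult_ac)
  hence e_ge': "(p + 4) * d * M\<^sup>2 \<le> e (p - 1)" by (simp only: mult_less_cancel1 less_Suc_eq_le)
  have "M \<le> M * M" using M by (cases M) auto
  have "1 * (M * M) \<le> d * (M * M)" using d(1) by (intro mult_le_mono) auto
  have "M * (M + 1 + p * d * M) < (p + 4) * d * M\<^sup>2"
  proof -
    have "M * (M + 1 + p * d * M) = M * M + M + p * (d * (M * M))" by (simp add: algebra_simps)
    moreover have "(p + 4) * d * M\<^sup>2 = 4 * (d * (M * M)) + p * (d * (M * M))"
      by (simp add: algebra_simps power2_eq_square)
    moreover have "M * M > 0" using M by simp
    ultimately show ?thesis using \<open>M \<le> M * M\<close> \<open>1 * (M * M) \<le> d * (M * M)\<close> by linarith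
  qed
  \<comment> \<open>This is Stepanov's counting condition after cancelling \<open>d\<close> and the
    term \<open>e (p - 1) * M\<close> on both sides.\<close>
  hence "M * (M + 1 + p * d * M) < e (p - 1)" using e_ge' by linarith
  hence "(e (p - 1) + (M + 1) + p * (d * M)) * M < e (p - 1) * (M + 1)"
    by (simp add: algebra_simps)
  hence "d * ((e (p - 1) + (M + 1) + p * (d * M)) * M) < d * (e (p - 1) * (M + 1))"
    using d(1) by simp
  hence card: "(e (p - 1) + (M + 1) + p * (d * M)) * (d * M) < e (p - 1) * (M + 1) * d"
    by (simp only: mult_ac)
  have "d * M \<le> q"
  proof -
    have "d * M * 1 \<le> d * M * ((p + 4) * d * M)"
      using d(1) M by (intro mult_le_mono2) simp
    also have "\<dots> = (p + 4) * d\<^sup>2 * M\<^sup>2" by (simp add: power2_eq_square mult_ac)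
    finally show ?thesis using M by simp
  qed
  have "d * M * card S \<le> e (p - 1) + q * (M + 1 - 1) + (d - 1) * (\<Sum>i<p. e i)"
  proof (rule stepanov_degree_bound[where e = e and ?i0.0 = "p - 1" and \<zeta> = \<zeta>, OF _ _ inj_conjugate _ _ _ _ e_le \<open>d * M \<le> q\<close> card])
    show "q = CHAR('a) ^ r" "p - 1 < p" using p_ge_2 by (simp_all add: q_def p_def)
    show "b ^ q = b" if "b \<in> S" for b using that by (simp add: S_def K_def)
    show "(\<Prod>i<p. (b + conjugate i) ^ e i) = \<zeta>" if "b \<in> S" for b
      using that power_line[OF _ m_less, of b] by (auto simp: S_def e_def)
    show "b + conjugate i \<noteq> 0" if "b \<in> S" for b i
      using that add_theta_nonzero by (simp add: S_def add_conjugate)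
  qed simp
  also have "\<dots> \<le> q + q * M + (d - 1) * (p * q)"
  proof -
    have "e i \<le> q" for i using q_ge_2 by (simp add: e_def less_imp_le)
    thus ?thesis using sum_bounded_above[of "{..<p}" e q] by (intro add_mono mult_le_mono) auto
  qed
  also have "\<dots> \<le> d * q + q * M + d * (p * q)"
    using d(1) by (intro add_mono mult_le_mono) auto
  also have "\<dots> = q * M + d * (p + 1) * q" by (simp add: algebra_simps)
  finally show ?thesis by (simp add: S_def m_def mult_ac)
qed

text \<open>Applying Frobenius to the equation shows that the difference of two polynomials of
  degree \<open>p - 1\<close> vanishes at all \<open>p\<close> conjugates of
  \<open>\<theta>\<close>, hence is zero. Leading coefficients give \<open>c = c'\<close>, and roots
  give \<open>T = T'\<close>.\<close>

lemma products_on_line_inj: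
  assumes T: "T \<subseteq> K" "T' \<subseteq> K" "card T = p - 1" "card T' = p - 1"
    and c: "c \<in> K" "c' \<in> K" "c \<noteq> 0"
    and eq: "c * (\<Prod>b\<in>T. \<theta> + b) = c' * (\<Prod>b\<in>T'. \<theta> + b)"
  shows "c = c' \<and> T = T'"
proof -
  define F where "F = (\<lambda>T :: 'a set. \<Prod>b\<in>T. [:b, 1:])"
  define f where "f = smult c (F T) - smult c' (F T')"
  have F: "degree (F T) = card T" "Polynomial.coeff (F T) (card T) = 1" for T
  proof -
    show "degree (F T) = card T"
      unfolding F_def by (subst degree_prod_sum_eq) auto
    have "lead_coeff (F T) = 1" unfolding F_def lead_coeff_prod by simp
    thus "Polynomial.coeff (F T) (card T) = 1" using \<open>degree (F T) = card T\<close> by simp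
  qed
  have F_eval: "poly (smult a (F T)) (conjugate i) = (a * (\<Prod>b\<in>T. \<theta> + b)) ^ q ^ i"
    if "T \<subseteq> K" "a \<in> K" for T i a
  proof -
    have "poly (F T) (conjugate i) = (\<Prod>b\<in>T. (\<theta> + b) ^ q ^ i)"
      unfolding F_def poly_prod
      by (intro prod.cong refl) (use that in \<open>auto simp: add_conjugate[symmetric]\<close>)
    thus ?thesis using K_frobenius[OF that(2)] by (simp add: power_mult_distrib prod_power_distrib)
  qed
  have "f = 0"
  proof (rule ccontr)
    assume f: "f \<noteq> 0"
    have "conjugate ` {..<p} \<subseteq> {x. poly f x = 0}"
      using T(1,2) c F_eval eq by (auto simp: f_def)
    hence "card (conjugate ` {..<p}) \<le> card {x. poly f x = 0}"
      by (intro card_mono) auto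
    also have "\<dots> \<le> degree f" using f by (rule card_poly_roots_bound)
    also have "\<dots> \<le> p - 1"
      unfolding f_def using T F(1) by (intro degree_diff_le order_trans[OF degree_smult_le]) auto
    finally show False using inj_conjugate p_ge_2 by (simp add: card_image)
  qed
  hence "Polynomial.coeff f (p - 1) = 0" by simp
  hence "c = c'" using F(2)[of T] F(2)[of T'] T by (simp add: f_def)
  moreover from this have "F T = F T'" using \<open>f = 0\<close> c by (simp add: f_def flip: smult_diff_right)
  hence "{x. poly (F T) (- x) = 0} = {x. poly (F T') (- x) = 0}" by simp
  hence "T = T'" by (simp add: F_def poly_prod)
  ultimately show ?thesis by simp
qed

text \<open>Let \<open>m = (q ^ p - 1) div d\<close>. As \<open>d dvd N\<close>, \<open>m\<close> is
  a multiple of \<open>q - 1\<close>, so nonzero scalars from \<open>K\<close> are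
  \<open>m\<close>-th roots of unity. So are the scaled products; there are at most
  \<open>m = (N div d) * (q - 1)\<close> of them, and the \<open>q - 1\<close> scalars
  cancel.\<close>

lemma card_power_residues_choose_le:
  assumes d: "d dvd N"
  shows "(card {b \<in> K. (\<theta> + b) ^ ((q ^ p - 1) div d) = 1} choose (p - 1)) \<le> N div d"
proof -
  define X where "X = {b \<in> K. (\<theta> + b) ^ ((q ^ p - 1) div d) = 1}"
  define m where "m = (q ^ p - 1) div d"
  define Ts where "Ts = {T. T \<subseteq> X \<and> card T = p - 1}"
  define f where "f = (\<lambda>(c, T). c * (\<Prod>b\<in>T. \<theta> + b))"
  have Npos: "N > 0" using N_mult q_ge_2 p_ge_2
    by (metis N_def gr0I lessThan_iff not_less0 not_numeral_le_zero power_0 sum_eq_0_iff zero_neq_one finite_lessThan gr_implies_not0)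
  have m: "m = (N div d) * (q - 1)"
    unfolding m_def N_mult[symmetric] using d by (metis div_mult_swap mult.commute)
  have K0: "card (K - {0}) = q - 1"
    using card_fixed q_ge_2 by (subst card_Diff_singleton) (auto simp: K_def power_0_left)
  have "inj_on f ((K - {0}) \<times> Ts)"
  proof (rule inj_onI)
    fix u v assume *: "u \<in> (K - {0}) \<times> Ts" "v \<in> (K - {0}) \<times> Ts" "f u = f v"
    obtain c T c' T' where uv: "u = (c, T)" "v = (c', T')" by (cases u, cases v)
    show "u = v"
      using products_on_line_inj[of T T' c c'] * by (auto simp: uv f_def Ts_def X_def)
  qed
  hence card_f: "card (f ` ((K - {0}) \<times> Ts)) = card ((K - {0}) \<times> Ts)"
    by (rule card_image)
  have "f ` ((K - {0}) \<times> Ts) \<subseteq> {x. x ^ m = 1}"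
  proof (rule image_subsetI)
    fix u assume "u \<in> (K - {0}) \<times> Ts"
    then obtain c T where u: "u = (c, T)" and c: "c \<in> K" "c \<noteq> 0" and T: "T \<in> Ts" by auto
    have "c * c ^ (q - 1) = c * 1" using c q_ge_2 by (simp add: K_def flip: power_Suc)
    hence "c ^ (q - 1) = 1" using c by simp
    hence "c ^ m = 1" unfolding m by (metis mult.commute power_mult power_one)
    moreover have "(\<Prod>b\<in>T. (\<theta> + b) ^ m) = 1"
      using T by (intro prod.neutral) (auto simp: Ts_def X_def m_def)
    ultimately show "f u \<in> {x. x ^ m = 1}"
      by (simp add: u f_def power_mult_distrib prod_power_distrib)
  qed
  hence "card ((K - {0}) \<times> Ts) \<le> card {x :: 'a. x ^ m = 1}"
    unfolding card_f[symmetric] by (intro card_mono) auto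
  also have "\<dots> \<le> m"
    using q_ge_2 Npos d unfolding m by (intro card_roots_of_unity_le) (auto simp: dvd_imp_le div_greater_zero_iff dvd_pos_nat)
  also have "card ((K - {0}) \<times> Ts) = (q - 1) * (card X choose (p - 1))"
    by (simp add: card_cartesian_product K0 Ts_def n_subsets)
  finally show ?thesis using q_ge_2 by (simp add: m X_def mult.commute)
qed

text \<open>Stepanov's method gives only upper bounds. The lower bound follows because at most
  \<open>d\<close> classes cover \<open>K\<close> and each of the others obeys the upper
  bound.\<close>

lemma card_power_residues_estimate:
  assumes d: "d > 0" "d dvd q ^ p - 1" and M: "M > 0" "(p + 4) * d\<^sup>2 * M\<^sup>2 < q"
  shows "\<bar>real (card {b \<in> K. (\<theta> + b) ^ ((q ^ p - 1) div d) = 1}) - real q / real d\<bar>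
    \<le> real d * (real (p + 1) * real q / real M)"
proof -
  define m where "m = (q ^ p - 1) div d"
  define X where "X = (\<lambda>\<zeta>. {b \<in> K. (\<theta> + b) ^ m = \<zeta>})"
  define E where "E = real (p + 1) * real q / real M"
  define Z where "Z = {z :: 'a. z ^ d = 1}"
  have E: "E \<ge> 0" by (simp add: E_def)
  have upper: "real (card (X \<zeta>)) \<le> real q / real d + E" for \<zeta>
  proof -
    have "real (M * d * card (X \<zeta>)) \<le> real (q * M + d * (p + 1) * q)"
      using card_power_residue_class_le[OF d M, of \<zeta>] unfolding X_def m_def of_nat_le_iff .
    thus ?thesis using d(1) M(1) by (simp add: E_def field_simps)
  qed
  have "(\<theta> + b) ^ m \<in> Z" if "b \<in> K" for b
  proof -
    have "m * d = q ^ p - 1" unfolding m_def using d(2) by (rule dvd_div_mult_self)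
    hence "((\<theta> + b) ^ m) ^ d = (\<theta> + b) ^ (q ^ p - 1)" by (metis power_mult)
    moreover have "(\<theta> + b) * (\<theta> + b) ^ (q ^ p - 1) = \<theta> + b"
    proof -
      have "Suc (q ^ p - 1) = q ^ p" using q_ge_2 by simp
      thus ?thesis using frobenius_p[of "\<theta> + b"] by (metis power_Suc)
    qed
    ultimately show ?thesis using add_theta_nonzero[OF that] by (simp add: Z_def)
  qed
  hence "K = (\<Union>\<zeta>\<in>Z. X \<zeta>)" by (auto simp: X_def)
  hence "q \<le> (\<Sum>\<zeta>\<in>Z. card (X \<zeta>))"
    using card_fixed card_UN_le[of Z X] by (simp add: K_def)
  also have "\<dots> = card (X 1) + (\<Sum>\<zeta>\<in>Z - {1}. card (X \<zeta>))"
    by (rule sum.remove) (auto simp: Z_def)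
  finally have "real q \<le> real (card (X 1)) + (\<Sum>\<zeta>\<in>Z - {1}. real (card (X \<zeta>)))"
    by (simp flip: of_nat_sum of_nat_add)
  also have "(\<Sum>\<zeta>\<in>Z - {1}. real (card (X \<zeta>))) \<le> real (card (Z - {1})) * (real q / real d + E)"
    by (rule sum_bounded_above) (use upper in auto)
  also have "\<dots> \<le> (real d - 1) * (real q / real d + E)"
  proof (rule mult_right_mono)
    have "card Z \<le> d" unfolding Z_def by (rule card_roots_of_unity_le[OF d(1)])
    hence "card (Z - {1}) \<le> d - 1" by (simp add: Z_def card_Diff_singleton)
    hence "real (card (Z - {1})) \<le> real (d - 1)" by (rule of_nat_mono)
    thus "real (card (Z - {1})) \<le> real d - 1" using d(1) by (simp add: of_nat_diff)
  qed (use E in simp)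
  also have "(real d - 1) * (real q / real d + E) = real q - real q / real d + (real d - 1) * E"
    using d(1) by (simp add: field_simps)
  finally have "real q / real d - (real d - 1) * E \<le> real (card (X 1))" by linarith
  moreover have "E \<le> real d * E" using d(1) E by (simp add: mult_le_cancel_right1)
  ultimately have "\<bar>real (card (X 1)) - real q / real d\<bar> \<le> real d * E"
    using upper[of 1] E by (simp add: abs_le_iff algebra_simps)
  thus ?thesis by (simp add: X_def m_def E_def)
qed

text \<open>The binomial coefficient is at least \<open>(x / (p - 1)) ^ (p - 1)\<close> when
  \<open>x \<ge> p - 1\<close>. For smaller \<open>x\<close> this power is at most \<open>1\<close>,
  hence below \<open>N / d\<close>.\<close>

lemma card_power_residues_power_le:
  assumes d: "d dvd N"
  shows "real (card {b \<in> K. (\<theta> + b) ^ ((q ^ p - 1) div d) = 1}) ^ (p - 1)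
    \<le> real (p - 1) ^ (p - 1) * (2 * real q ^ (p - 1) / real d)"
proof -
  define x where "x = card {b \<in> K. (\<theta> + b) ^ ((q ^ p - 1) div d) = 1}"
  have d0: "d > 0" using d N_pos by (rule dvd_pos_nat[rotated])
  have N1: "1 \<le> real N / real d" using d0 dvd_imp_le[OF d N_pos] by simp
  have "(real x / real (p - 1)) ^ (p - 1) \<le> real N / real d"
  proof (cases "p - 1 \<le> x")
    case True
    hence "(real x / real (p - 1)) ^ (p - 1) \<le> real (x choose (p - 1))"
      by (rule binomial_ge_n_over_k_pow_k)
    also have "\<dots> \<le> real (N div d)"
      using card_power_residues_choose_le[OF d] by (simp add: x_def)
    also have "\<dots> = real N / real d" using d by (simp add: real_of_nat_div)
    finally show ?thesis .
  next
    case False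
    hence "(real x / real (p - 1)) ^ (p - 1) \<le> 1" by (intro power_le_one) auto
    thus ?thesis using N1 by linarith
  qed
  also have "\<dots> \<le> (2 * real q ^ (p - 1)) / real d"
    using of_nat_mono[OF N_le, where ?'a = real] by (intro divide_right_mono) simp_all
  finally show ?thesis using p_ge_2 unfolding x_def[symmetric] by (simp add: power_divide field_simps)
qed

text \<open>For \<open>b \<in> K\<close> a discrete logarithm to the base \<open>g\<close>. It is
  determined only modulo \<open>q ^ p - 1\<close>, which does not affect divisibility by divisors of
  that number.\<close>

definition ind :: "'a \<Rightarrow> nat" where "ind b = (SOME i. \<theta> + b = g ^ i)"

lemma ind: "b \<in> K \<Longrightarrow> \<theta> + b = g ^ ind b"
  unfolding ind_def by (rule someI_ex) (intro gen add_theta_nonzero)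

lemma power_residue_iff:
  assumes "b \<in> K" "d dvd q ^ p - 1"
  shows "(\<theta> + b) ^ ((q ^ p - 1) div d) = 1 \<longleftrightarrow> d dvd ind b"
proof -
  define m where "m = (q ^ p - 1) div d"
  have m: "q ^ p - 1 = d * m" unfolding m_def using assms(2) by simp
  have "q ^ 1 < q ^ p" using q_ge_2 p_ge_2 by (intro power_strict_increasing) auto
  hence "m > 0" using q_ge_2 by (intro gr0I) (use m in simp)
  have "(\<theta> + b) ^ m = 1 \<longleftrightarrow> g ^ (ind b * m) = 1"
    using ind[OF assms(1)] by (simp add: power_mult)
  also have "\<dots> \<longleftrightarrow> d * m dvd ind b * m" unfolding g_power_eq_1_iff m ..
  also have "\<dots> \<longleftrightarrow> d dvd ind b" using \<open>m > 0\<close> by simp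
  finally show ?thesis by (simp add: m_def)
qed

text \<open>The sieve is fed from two sources: the residue estimate for \<open>d\<close> up to
  \<open>q powr (1 / 16)\<close>, the count of products beyond. The exponent in \<open>E\<close>
  accommodates the weaker of the two savings.\<close>

lemma exists_index_coprime:
  fixes C :: real
  assumes C: "C \<ge> 1" "\<And>N. N > 0 \<Longrightarrow> 4 ^ card (prime_factors N) \<le> C * real N powr (1 / (32 * (real p)\<^sup>2))"
    and large: "2 * (real p + 1) * C < real q powr (1 / (32 * real p))"
  shows "\<exists>b\<in>K. coprime (ind b) N"
proof -
  define E where "E = 2 * (real p + 1) * real q powr (1 - 1 / (16 * real p))"
  have q: "1 < real q" using q_ge_2 by simp
  have p: "2 \<le> real p" using p_ge_2 by simp
  have q_mono: "real q powr x \<le> real q powr y" if "x \<le> y" for x y :: real using q that by (intro powr_mono) auto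
  have large': "real p + 4 < real q powr (3 / 8)"
  proof -
    have "real p + 4 \<le> 2 * (real p + 1) * 1" using p by simp
    also have "\<dots> \<le> 2 * (real p + 1) * C" using C(1) by (intro mult_left_mono) auto
    also note large
    also have "real q powr (1 / (32 * real p)) \<le> real q powr (3 / 8)" using p by (intro q_mono) (simp add: field_simps)
    finally show ?thesis by simp
  qed
  have bound: "\<bar>real (card {b \<in> K. d dvd ind b}) - real (card K) / real d\<bar> \<le> E" if d: "d dvd N" for d
  proof -
    have dQ: "d dvd q ^ p - 1" unfolding N_mult[symmetric] using d by simp
    have d0: "d > 0" using d N_pos by (rule dvd_pos_nat[rotated])
    define X where "X = {b \<in> K. (\<theta> + b) ^ ((q ^ p - 1) div d) = 1}"
    have X: "{b \<in> K. d dvd ind b} = X" using power_residue_iff[OF _ dQ] by (auto simp: X_def)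
    have "\<bar>real (card X) - real q / real d\<bar> \<le> E"
    proof (cases "d \<le> real q powr (1 / 16)")
      case True
      \<comment> \<open>This size makes \<open>d\<^sup>2 * M\<^sup>2\<close> at most
        \<open>q powr (5 / 8)\<close>, leaving \<open>q powr (3 / 8)\<close> for
        \<open>p + 4\<close>, and the error is of order \<open>q powr (13 / 16)\<close>.\<close>
      define M where "M = nat \<lfloor>q powr (1 / 4)\<rfloor>"
      have ge1: "1 \<le> real q powr (1 / 4)" using q by (intro ge_one_powr_ge_zero) auto
      have "1 \<le> \<lfloor>real q powr (1 / 4)\<rfloor>" using ge1 by (simp add: le_floor_iff)
      hence M_le: "real M \<le> real q powr (1 / 4)" and "real q powr (1 / 4) < real M + 1" "1 \<le> real M"
        using ge1 unfolding M_def by linarith+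
      hence M_ge: "real q powr (1 / 4) / 2 \<le> real M" by linarith
      have M0: "M > 0" using M_ge ge1 by (intro gr0I) auto
      have "real ((p + 4) * d\<^sup>2 * M\<^sup>2) = real (p + 4) * (real d)\<^sup>2 * (real M)\<^sup>2" by simp
      also have "\<dots> \<le> real (p + 4) * (real q powr (1 / 16))\<^sup>2 * (real q powr (1 / 4))\<^sup>2"
        using True M_le by (intro mult_mono power_mono) auto
      also have "\<dots> = real (p + 4) * (real q powr (5 / 8))"
        using q by (simp add: power2_eq_square flip: powr_add)
      also have "\<dots> < real q powr (3 / 8) * real q powr (5 / 8)"
        using large' q by (intro mult_strict_right_mono) auto
      also have "\<dots> = q" using q by (simp flip: powr_add)
      finally have small: "(p + 4) * d\<^sup>2 * M\<^sup>2 < q" by (simp only: of_nat_less_iff)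
      have "\<bar>real (card X) - real q / real d\<bar> \<le> real d * (real (p + 1) * real q / real M)"
        unfolding X_def by (rule card_power_residues_estimate[OF d0 dQ M0 small])
      also have "\<dots> \<le> real q powr (1 / 16) * (real (p + 1) * real q / (real q powr (1 / 4) / 2))"
        using True M_ge M0 q by (intro mult_mono divide_left_mono mult_pos_pos) auto
      also have "\<dots> = 2 * (real p + 1) * (real q powr (1 / 16) * real q powr 1 * real q powr (- (1 / 4)))"
        using q by (simp add: powr_minus field_simps)
      also have "real q powr (1 / 16) * real q powr 1 * real q powr (- (1 / 4)) = real q powr (13 / 16)"
        by (simp only: powr_add[symmetric]) simp
      also have "2 * (real p + 1) * real q powr (13 / 16) \<le> E"
        unfolding E_def using p by (intro mult_left_mono q_mono) (auto simp: field_simps)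
      finally show ?thesis .
    next
      case False
      \<comment> \<open>For large \<open>d\<close> the term \<open>q / d\<close> is itself at most
        \<open>E\<close>, so an upper bound on \<open>card X\<close> suffices. The root of order
        \<open>p - 1\<close> weakens the saving to \<open>q powr (- (1 / (16 * p)))\<close>.\<close>
      have "1 / real d \<le> 1 / real q powr (1 / 16)"
        using False q d0 by (intro divide_left_mono mult_pos_pos) auto
      hence inv_d: "1 / real d \<le> real q powr (- (1 / 16))" by (simp add: powr_minus field_simps)
      have "real (card X) ^ (p - 1) \<le> real (p - 1) ^ (p - 1) * (2 * real q ^ (p - 1) / real d)"
        unfolding X_def by (rule card_power_residues_power_le[OF d])
      also have "\<dots> = real (p - 1) ^ (p - 1) * (2 ^ 1 * real q ^ (p - 1) * (1 / real d))" by simp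
      also have "\<dots> \<le> real (p - 1) ^ (p - 1) * (2 ^ (p - 1) * real q ^ (p - 1) * (real q powr (- (1 / (16 * real p)))) ^ (p - 1))"
      proof (intro mult_left_mono mult_mono)
        have "real q powr (- (1 / 16)) \<le> real q powr (- (1 / (16 * real p)) * real (p - 1))"
          using p by (intro q_mono) (simp add: field_simps)
        also have "\<dots> = (real q powr (- (1 / (16 * real p)))) ^ (p - 1)"
          using q by (simp add: powr_powr flip: powr_realpow)
        finally show "1 / real d \<le> (real q powr (- (1 / (16 * real p)))) ^ (p - 1)" using inv_d by linarith
        show "(2 :: real) ^ 1 \<le> 2 ^ (p - 1)" using p_ge_2 by (intro power_increasing) auto
      qed (use q in auto)
      also have "\<dots> = (real (p - 1) * (2 * (real q * real q powr (- (1 / (16 * real p)))))) ^ (p - 1)"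
        by (simp add: power_mult_distrib)
      also have "real q * real q powr (- (1 / (16 * real p))) = real q powr (1 - 1 / (16 * real p))"
        using q by (simp add: powr_diff powr_minus field_simps)
      finally have "real (card X) \<le> real (p - 1) * (2 * real q powr (1 - 1 / (16 * real p)))"
        by (subst (asm) power_mono_iff) (use p_ge_2 q in auto)
      also have "\<dots> \<le> E"
        unfolding E_def mult.assoc[symmetric]
        by (intro mult_right_mono) (use p_ge_2 in \<open>auto simp: of_nat_diff\<close>)
      finally have "real (card X) \<le> E" .
      moreover have "real q / real d \<le> E"
      proof -
        have "real q / real d \<le> real q * real q powr (- (1 / 16))"
          using mult_left_mono[OF inv_d, of "real q"] by simp
        also have "\<dots> = real q powr (15 / 16)" using q by (simp add: powr_mult_base)
        also have "\<dots> \<le> 1 * real q powr (1 - 1 / (16 * real p))" using p by (simp add: q_mono field_simps)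
        also have "\<dots> \<le> E" unfolding E_def by (intro mult_right_mono) auto
        finally show ?thesis .
      qed
      moreover have "real (card X) \<ge> 0" "real q / real d \<ge> 0" by simp_all
      ultimately show ?thesis by linarith
    qed
    thus ?thesis unfolding X using card_fixed by (simp add: K_def)
  qed
  \<comment> \<open>The number of prime factors costs \<open>q powr (1 / (32 * p))\<close>, and by
    \<open>large\<close> the constants cost less than the same again. Together this is exactly the
    saving in \<open>E\<close>.\<close>
  have "4 ^ card (prime_factors N) * E \<le> (C * real q powr (1 / (32 * real p))) * E"
  proof (rule mult_right_mono)
    have "4 ^ card (prime_factors N) \<le> C * real N powr (1 / (32 * (real p)\<^sup>2))" by (rule C(2)[OF N_pos])
    also have "\<dots> \<le> C * real (q ^ p) powr (1 / (32 * (real p)\<^sup>2))"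
      using N_le' C(1) by (intro mult_left_mono powr_mono2 of_nat_mono) auto
    also have "real (q ^ p) powr (1 / (32 * (real p)\<^sup>2)) = real q powr (1 / (32 * real p))"
      using q p by (simp add: powr_powr power2_eq_square flip: powr_realpow)
    finally show "4 ^ card (prime_factors N) \<le> C * real q powr (1 / (32 * real p))" .
  qed (simp add: E_def)
  also have "\<dots> = (2 * (real p + 1) * C) * (real q powr (1 / (32 * real p)) * real q powr (1 - 1 / (16 * real p)))"
    by (simp add: E_def)
  also have "\<dots> < real q powr (1 / (32 * real p)) * (real q powr (1 / (32 * real p)) * real q powr (1 - 1 / (16 * real p)))"
    using large q by (intro mult_strict_right_mono) auto
  also have "\<dots> = real q powr (1 / (32 * real p) + (1 / (32 * real p) + (1 - 1 / (16 * real p))))"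
    by (simp only: powr_add)
  also have "1 / (32 * real p) + (1 / (32 * real p) + (1 - 1 / (16 * real p))) = 1"
    using p by (simp add: field_simps)
  finally have small: "4 ^ card (prime_factors N) * E < card K"
    using q card_fixed by (simp add: K_def)
  show ?thesis using sieve_exists_coprime[OF _ N_pos bound small] by simp
qed

text \<open>Multiplying by \<open>a = g ^ (N * j)\<close> in \<open>K\<close> changes the index of
  \<open>\<theta> + b\<close> by a multiple of \<open>N\<close>. It stays coprime to
  \<open>N\<close>, and since \<open>N\<close> is invertible modulo \<open>q - 1\<close>, it can be
  made \<open>1\<close> modulo \<open>q - 1\<close>.\<close>

lemma exists_primitive_on_line:
  fixes C :: real
  assumes "C \<ge> 1" "\<And>N. N > 0 \<Longrightarrow> 4 ^ card (prime_factors N) \<le> C * real N powr (1 / (32 * (real p)\<^sup>2))"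
    and "2 * (real p + 1) * C < real q powr (1 / (32 * real p))"
  shows "\<exists>a b. a \<in> K \<and> a \<noteq> 0 \<and> b \<in> K \<and> (\<forall>x. x \<noteq> 0 \<longrightarrow> (\<exists>i. x = (a * (\<theta> + b)) ^ i))"
proof -
  obtain b where b: "b \<in> K" "coprime (ind b) N" using exists_index_coprime[OF assms] by auto
  define h where "h = q - 1"
  have h: "h > 0" "q - 1 = h" using q_ge_2 by (auto simp: h_def)
  obtain y z where yz: "N * y = h * z + 1"
    using coprime_N bezout_nat[of N h] N_pos unfolding h(2) coprime_iff_gcd_eq_1 by (metis less_irrefl)
  \<comment> \<open>Modulo \<open>h\<close> this is \<open>1 - ind b\<close>, written without
    subtracting \<open>ind b\<close> because the numbers are natural.\<close>
  define s where "s = 1 + (h - 1) * ind b"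
  have s: "ind b + s = h * ind b + 1" using h(1) by (cases h) (auto simp: s_def)
  define j where "j = y * s"
  define u where "u = ind b + N * j"
  have "u = ind b + (N * y) * s" by (simp add: u_def j_def)
  also have "\<dots> = (ind b + s) + h * z * s" unfolding yz by (simp add: algebra_simps)
  also have "\<dots> = (ind b + z * s) * h + 1" unfolding s by (simp add: algebra_simps)
  finally have u: "u = (ind b + z * s) * h + 1" .
  have "gcd h u = gcd h 1" unfolding u by (rule gcd_add_mult)
  hence "coprime u h" by (simp add: coprime_iff_gcd_eq_1 gcd.commute)
  moreover have "gcd N (j * N + ind b) = gcd N (ind b)" by (rule gcd_add_mult)
  hence "coprime u N" using b(2) by (simp add: u_def coprime_iff_gcd_eq_1 gcd.commute add.commute mult.commute)
  ultimately have "gcd u (q ^ p - 1) = 1" unfolding N_mult[symmetric] h by simp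
  moreover have "u \<noteq> 0" using u by simp
  ultimately obtain v w where vw: "u * v = (q ^ p - 1) * w + 1"
    using bezout_nat[of u "q ^ p - 1"] by metis
  define a where "a = g ^ (N * j)"
  have "a ^ q = a"
  proof -
    have "a ^ (q - 1) = (g ^ (N * (q - 1))) ^ j" unfolding a_def power_mult[symmetric] by (simp add: mult_ac)
    hence "a ^ (q - 1) = 1" by (simp only: N_mult g_power_order power_one)
    moreover have "Suc (q - 1) = q" using q_ge_2 by simp
    ultimately show ?thesis by (metis mult.right_neutral power_Suc)
  qed
  moreover have "a * (\<theta> + b) = g ^ u" using ind[OF b(1)] by (simp add: a_def u_def power_add mult.commute)
  moreover have "\<exists>i. x = (g ^ u) ^ i" if "x \<noteq> 0" for x
  proof -
    obtain t where t: "x = g ^ t" using gen[OF \<open>x \<noteq> 0\<close>] by auto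
    have "(g ^ u) ^ v = g" unfolding power_mult[symmetric] vw
      by (simp only: power_add power_mult g_power_order power_one power_one_right mult_1)
    hence "x = (g ^ u) ^ (v * t)" by (simp add: t power_mult)
    thus ?thesis ..
  qed
  ultimately show ?thesis using b(1) g_nonzero by (intro exI[of _ a] exI[of _ b]) (auto simp: K_def a_def)
qed

end

theorem (in finite_field_extension) exists_primitive_with_D_order:
  fixes C :: real
  assumes C: "C \<ge> 1" "\<And>N. N > 0 \<Longrightarrow> 4 ^ card (prime_factors N) \<le> C * real N powr (1 / (32 * (real p)\<^sup>2))"
    and large: "2 * (real p + 1) * C < real q powr (1 / (32 * real p))"
    and j: "2 \<le> j" "j \<le> p"
  shows "\<exists>\<beta>. (\<forall>x. x \<noteq> 0 \<longrightarrow> (\<exists>i. x = \<beta> ^ i)) \<and> (D ^^ j) \<beta> = 0 \<and> (D ^^ (j - 1)) \<beta> \<noteq> 0"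
proof -
  obtain x where x: "(D ^^ (p - 1)) x \<noteq> 0" using D_power_nonzero ..
  \<comment> \<open>Since \<open>D ^^ p\<close> is zero, \<open>p - j\<close> steps starting from
    \<open>x\<close> leave an element annihilated in exactly \<open>j\<close> further steps. As
    \<open>j \<ge> 2\<close>, it lies outside \<open>K\<close>, and adding elements of
    \<open>K\<close> does not affect \<open>D ^^ (j - 1)\<close>.\<close>
  define \<theta> where "\<theta> = (D ^^ (p - j)) x"
  have \<theta>1: "(D ^^ (j - 1)) \<theta> \<noteq> 0"
    using x j unfolding \<theta>_def by (simp flip: funpow_add[THEN fun_cong, unfolded o_def])
  have \<theta>0: "(D ^^ j) \<theta> = 0"
    using D_power_p[of x] j unfolding \<theta>_def by (simp flip: funpow_add[THEN fun_cong, unfolded o_def])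
  have "\<theta> ^ q \<noteq> \<theta>"
    using \<theta>1 D_power_K[of \<theta> "j - 1"] j by (auto simp: K_def)
  then interpret line: finite_field_line g p q r \<theta>
    by unfold_locales
  obtain a b where ab: "a \<in> K" "a \<noteq> 0" "b \<in> K" "\<And>x. x \<noteq> 0 \<Longrightarrow> \<exists>i. x = (a * (\<theta> + b)) ^ i"
    using line.exists_primitive_on_line[OF C large] by blast
  have "(D ^^ i) (a * (\<theta> + b)) = a * (D ^^ i) \<theta>" if "i > 0" for i
    using that ab by (simp add: D_power_mult D_power_add D_power_K)
  thus ?thesis using ab(2,4) \<theta>0 \<theta>1 j by (intro exI[of _ "a * (\<theta> + b)"]) auto
qed

section \<open>Transfer to the fields of HOL-Algebra\<close>

text \<open>Scalars form a plain set, so that \<open>L\<close> can be the image of a subfield of a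
  record.\<close>

definition submodule_over :: "'b :: comm_ring_1 set \<Rightarrow> 'b set \<Rightarrow> bool" where
  "submodule_over L M \<longleftrightarrow> 0 \<in> M \<and> (\<forall>x\<in>M. \<forall>y\<in>M. x + y \<in> M) \<and> (\<forall>c\<in>L. \<forall>x\<in>M. c * x \<in> M)"

lemma submodule_overD:
  assumes "submodule_over L M"
  shows "0 \<in> M" "x \<in> M \<Longrightarrow> y \<in> M \<Longrightarrow> x + y \<in> M" "c \<in> L \<Longrightarrow> x \<in> M \<Longrightarrow> c * x \<in> M"
  using assms unfolding submodule_over_def by auto

locale field_bijection = field F for F :: "'a ring" (structure) +
  fixes \<psi> :: "'a \<Rightarrow> 'b :: finite_field"
  assumes bij: "bij_betw \<psi> (carrier F) UNIV"
    and hom_mult: "\<And>x y. x \<in> carrier F \<Longrightarrow> y \<in> carrier F \<Longrightarrow> \<psi> (x \<otimes> y) = \<psi> x * \<psi> y"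
    and hom_add: "\<And>x y. x \<in> carrier F \<Longrightarrow> y \<in> carrier F \<Longrightarrow> \<psi> (x \<oplus> y) = \<psi> x + \<psi> y"
    and hom_one: "\<psi> \<one> = 1"
begin

lemma inj: "inj_on \<psi> (carrier F)"
  using bij by (rule bij_betw_imp_inj_on)

lemma surj: obtains x where "x \<in> carrier F" "\<psi> x = y"
proof -
  have "y \<in> \<psi> ` carrier F" using bij_betw_imp_surj_on[OF bij] by simp
  thus thesis using that by auto
qed

lemma hom_zero: "\<psi> \<zero> = 0"
proof -
  have "\<psi> \<zero> + \<psi> \<zero> = \<psi> \<zero> + 0" using hom_add[of \<zero> \<zero>] by simp
  thus ?thesis by (rule add_left_imp_eq)
qed

lemma hom_minus: "x \<in> carrier F \<Longrightarrow> \<psi> (\<ominus> x) = - \<psi> x"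
  using hom_add[of x "\<ominus> x"] group_add_class.minus_unique[of "\<psi> x" "\<psi> (\<ominus> x)"] by (simp add: r_neg hom_zero)

lemma hom_pow: "x \<in> carrier F \<Longrightarrow> \<psi> (x [^] (n :: nat)) = \<psi> x ^ n"
  by (induction n) (simp_all add: hom_one hom_mult power_Suc2 del: power_Suc)

lemma hom_eq_iff: "x \<in> carrier F \<Longrightarrow> y \<in> carrier F \<Longrightarrow> \<psi> x = \<psi> y \<longleftrightarrow> x = y"
  using inj by (auto dest: inj_onD)

lemma finite_carrier: "finite (carrier F)"
  using bij_betw_finite[OF bij] by simp

lemma card_UNIV_eq: "card (UNIV :: 'b set) = order F"
  using bij_betw_same_card[OF bij] by (simp add: Coset.order_def)

lemma exists_generator: "\<exists>g :: 'b. g \<noteq> 0 \<and> (\<forall>x. x \<noteq> 0 \<longrightarrow> (\<exists>i. x = g ^ i))"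
proof -
  obtain a where a: "a \<in> carrier (mult_of F)" "carrier (mult_of F) = {a [^] i | i :: nat. i \<in> UNIV}"
    using finite_field_mult_group_has_gen[OF finite_carrier] by blast
  have a': "a \<in> carrier F" "a \<noteq> \<zero>" using a(1) by auto
  have "\<exists>i. x = \<psi> a ^ i" if "x \<noteq> 0" for x
  proof -
    obtain y where y: "y \<in> carrier F" "\<psi> y = x" by (rule surj)
    have "y \<noteq> \<zero>" using y(2) that hom_zero by auto
    hence "y \<in> carrier (mult_of F)" using y(1) by simp
    then obtain i :: nat where i: "y = a [^] i" unfolding a(2) by blast
    show ?thesis using hom_pow[OF a'(1), of i] unfolding i[symmetric] y(2) by (rule exI)
  qed
  moreover have "\<psi> a \<noteq> 0" using a'(2) hom_eq_iff[OF a'(1) zero_closed] unfolding hom_zero by blast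
  ultimately show ?thesis by blast
qed

lemma primitive_elementI:
  assumes \<beta>: "\<beta> \<in> carrier F" and gen: "\<And>x. x \<noteq> 0 \<Longrightarrow> \<exists>i. x = \<psi> \<beta> ^ i"
    and nz: "\<beta> \<noteq> \<zero>"
  shows "primitive_element F \<beta>"
proof -
  have \<beta>': "\<beta> \<in> carrier (mult_of F)" using \<beta> nz by simp
  have "finite (carrier (mult_of F))" using finite_carrier by simp
  hence gen_eq: "generate (mult_of F) {\<beta>} = {\<beta> [^] k | k :: nat. k \<in> UNIV}"
    using group.generate_pow_on_finite_carrier[OF field_mult_group _ \<beta>'] by (simp add: nat_pow_mult_of)
  have "generate (mult_of F) {\<beta>} = carrier (mult_of F)"
  proof
    show "generate (mult_of F) {\<beta>} \<subseteq> carrier (mult_of F)"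
      using group.generate_incl[OF field_mult_group, of "{\<beta>}"] \<beta>' by simp
    show "carrier (mult_of F) \<subseteq> generate (mult_of F) {\<beta>}"
    proof
      fix x assume "x \<in> carrier (mult_of F)"
      hence x: "x \<in> carrier F" "x \<noteq> \<zero>" by auto
      hence "\<psi> x \<noteq> 0" using hom_eq_iff[OF x(1) zero_closed] unfolding hom_zero by blast
      then obtain i where "\<psi> x = \<psi> \<beta> ^ i" using gen by blast
      hence "\<psi> x = \<psi> (\<beta> [^] i)" unfolding hom_pow[OF \<beta>] .
      hence "x = \<beta> [^] i" using hom_eq_iff[OF x(1) nat_pow_closed[OF \<beta>]] by blast
      thus "x \<in> generate (mult_of F) {\<beta>}" unfolding gen_eq by blast
    qed
  qed
  thus ?thesis unfolding primitive_element_def using \<beta>' by simp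
qed

context
  fixes K assumes K: "subfield K F"
begin

lemma K_subset: "K \<subseteq> carrier F"
  using K subfieldE(3) by blast

lemma submodule_image_Span:
  assumes "set Us \<subseteq> carrier F"
  shows "submodule_over (\<psi> ` K) (\<psi> ` Span K Us)"
proof -
  note S = Span_subgroup_props[OF K assms] Span_smult_closed[OF K assms]
  show ?thesis
    unfolding submodule_over_def
  proof (intro conjI ballI)
    have "\<psi> \<zero> \<in> \<psi> ` Span K Us" using S(2) by (rule imageI)
    thus "0 \<in> \<psi> ` Span K Us" unfolding hom_zero .
  next
    fix x y assume "x \<in> \<psi> ` Span K Us" "y \<in> \<psi> ` Span K Us"
    then obtain u v where uv: "u \<in> Span K Us" "v \<in> Span K Us" "x = \<psi> u" "y = \<psi> v" by blast
    have "u \<in> carrier F" "v \<in> carrier F" using uv(1,2) S(1) by blast+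
    moreover have "\<psi> (u \<oplus> v) \<in> \<psi> ` Span K Us" using S(3)[OF uv(1,2)] by (rule imageI)
    ultimately show "x + y \<in> \<psi> ` Span K Us" by (simp only: uv(3,4) hom_add)
  next
    fix c x assume "c \<in> \<psi> ` K" "x \<in> \<psi> ` Span K Us"
    then obtain u v where uv: "u \<in> K" "v \<in> Span K Us" "c = \<psi> u" "x = \<psi> v" by blast
    have "u \<in> carrier F" "v \<in> carrier F" using uv(1,2) S(1) K_subset by blast+
    moreover have "\<psi> (u \<otimes> v) \<in> \<psi> ` Span K Us" using S(5)[OF uv(1,2)] by (rule imageI)
    ultimately show "c * x \<in> \<psi> ` Span K Us" by (simp only: uv(3,4) hom_mult)
  qed
qed

text \<open>The preimage of \<open>M\<close> is an additive subgroup, with negatives from the scalar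
  \<open>-1\<close>, so minimality of \<open>Span\<close> in \<open>F\<close> applies to it.\<close>

lemma image_Span_minimal:
  assumes Us: "set Us \<subseteq> carrier F" and M: "submodule_over (\<psi> ` K) M" and "\<psi> ` set Us \<subseteq> M"
  shows "\<psi> ` Span K Us \<subseteq> M"
proof -
  define E where "E = {x \<in> carrier F. \<psi> x \<in> M}"
  have neg1: "-1 \<in> \<psi> ` K"
  proof -
    have "\<ominus> \<one> \<in> K" using subringE(3,5)[OF subfieldE(1)[OF K]] by blast
    hence "\<psi> (\<ominus> \<one>) \<in> \<psi> ` K" by (rule imageI)
    thus ?thesis by (simp only: hom_minus[OF one_closed] hom_one)
  qed
  have "subgroup E (add_monoid F)"
  proof (rule add.subgroupI)
    show "E \<subseteq> carrier F" by (auto simp: E_def)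
    have "\<zero> \<in> E" using submodule_overD(1)[OF M] by (simp add: E_def hom_zero)
    thus "E \<noteq> {}" by blast
    show "\<ominus> x \<in> E" if "x \<in> E" for x
      using that submodule_overD(3)[OF M neg1, of "\<psi> x"] by (simp add: E_def hom_minus)
    show "x \<oplus> y \<in> E" if "x \<in> E" "y \<in> E" for x y
      using that submodule_overD(2)[OF M, of "\<psi> x" "\<psi> y"] by (simp add: E_def hom_add)
  qed
  moreover have "K <#> set Us \<subseteq> E"
  proof
    fix z assume "z \<in> K <#> set Us"
    then obtain c u where cu: "c \<in> K" "u \<in> set Us" and z: "z = c \<otimes> u"
      unfolding set_mult_def by blast
    have "c \<in> carrier F" "u \<in> carrier F" using cu K_subset Us by blast+
    moreover have "\<psi> c * \<psi> u \<in> M" using cu assms(3) by (intro submodule_overD(3)[OF M]) auto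
    ultimately show "z \<in> E" by (simp add: E_def hom_mult z)
  qed
  ultimately have "Span K Us \<subseteq> E" using Span_min[OF K Us] by blast
  thus ?thesis by (auto simp: E_def)
qed

lemma image_set_subset_Span: "set Us \<subseteq> carrier F \<Longrightarrow> \<psi> ` set Us \<subseteq> \<psi> ` Span K Us"
  using Span_base_incl[OF K] by blast

end
end

text \<open>With \<open>y = \<psi> \<beta>\<close>, the \<open>j\<close> elements
  \<open>(D ^^ i) y\<close> for \<open>i < j\<close> form a basis of the span of the conjugates.
  Both spans contain \<open>y\<close> and are closed under \<open>D\<close>, hence under Frobenius,
  which is \<open>D\<close> plus the identity.\<close>

lemma (in field_bijection) k_normalI:
  assumes ext: "finite_field_extension (g :: 'b) p q r" and K: "subfield K F" "card K = q"
    and \<psi>K: "\<psi> ` K = {b :: 'b. b ^ q = b}" and \<beta>: "\<beta> \<in> carrier F" and j: "1 \<le> j" "j \<le> p"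
    and D: "(finite_field_extension.D q ^^ j) (\<psi> \<beta>) = 0" "(finite_field_extension.D q ^^ (j - 1)) (\<psi> \<beta>) \<noteq> 0"
  shows "k_normal F K p (p - j) \<beta>"
proof -
  interpret ext: finite_field_extension g p q r by (rule ext)
  define y where "y = \<psi> \<beta>"
  define u where "u = (\<lambda>i. inv_into (carrier F) \<psi> ((ext.D ^^ i) y))"
  have u: "u i \<in> carrier F" "\<psi> (u i) = (ext.D ^^ i) y" for i
    using bij unfolding u_def by (auto simp: bij_betw_def inv_into_into f_inv_into_f)
  define conj where "conj = (\<lambda>i. \<beta> [^] (q ^ i))"
  have conj: "conj i \<in> carrier F" "\<psi> (conj i) = y ^ (q ^ i)" for i
    using \<beta> by (simp_all add: conj_def hom_pow y_def)
  define Us where "Us = map u [0..<j]"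
  define Cs where "Cs = map conj [0..<p]"
  have Us: "set Us \<subseteq> carrier F" and Cs: "set Cs \<subseteq> carrier F"
    using u(1) conj(1) by (auto simp: Us_def Cs_def)

  have D_closed: "ext.D x \<in> M" if sub: "submodule_over (\<psi> ` K) M"
    and gens: "\<And>v. v \<in> set Vs \<Longrightarrow> ext.D (\<psi> v) \<in> M" and Vs: "set Vs \<subseteq> carrier F"
    and x: "x \<in> \<psi> ` Span K Vs" for Vs M x
  proof -
    have "submodule_over (\<psi> ` K) {x. ext.D x \<in> M}"
      using submodule_overD[OF sub] unfolding submodule_over_def \<psi>K
      by (auto simp: ext.D_0 ext.D_add ext.D_mult ext.K_def)
    hence "\<psi> ` Span K Vs \<subseteq> {x. ext.D x \<in> M}"
      using gens by (intro image_Span_minimal[OF K(1) Vs]) auto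
    thus ?thesis using x by auto
  qed

  \<comment> \<open>Vectors are added from the end of the list: \<open>D ^^ (j - 1 - i)\<close>
    annihilates all later ones but sends the one of index \<open>i\<close> to
    \<open>(D ^^ (j - 1)) y\<close>, which is nonzero.\<close>
  have "independent K (map u [j - l..<j])" if "l \<le> j" for l
    using that
  proof (induction l)
    case (Suc l)
    define i where "i = j - Suc l"
    have i: "Suc i = j - l" "i < j" using Suc.prems by (simp_all add: i_def)
    have tail: "set (map u [Suc i..<j]) \<subseteq> carrier F" using u(1) by auto
    have "u i \<notin> Span K (map u [Suc i..<j])"
    proof
      assume *: "u i \<in> Span K (map u [Suc i..<j])"
      have "submodule_over (\<psi> ` K) {x. (ext.D ^^ (j - 1 - i)) x = 0}"
        unfolding submodule_over_def \<psi>K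
        by (auto simp: ext.D_power_0 ext.D_power_add ext.D_power_mult ext.K_def)
      hence "\<psi> ` Span K (map u [Suc i..<j]) \<subseteq> {x. (ext.D ^^ (j - 1 - i)) x = 0}"
      proof (rule image_Span_minimal[OF K(1) tail])
        have "(ext.D ^^ (j - 1 - i)) ((ext.D ^^ i') y) = 0" if "Suc i \<le> i'" "i' < j" for i'
        proof -
          have "(ext.D ^^ (j - 1 - i)) ((ext.D ^^ i') y) = (ext.D ^^ ((i' - Suc i) + j)) y"
            using that by (simp add: add.commute flip: funpow_add[THEN fun_cong, unfolded o_def])
          also have "\<dots> = (ext.D ^^ (i' - Suc i)) 0"
            unfolding funpow_add o_def using D(1) by (simp add: y_def)
          finally show ?thesis by (simp add: ext.D_power_0)
        qed
        thus "\<psi> ` set (map u [Suc i..<j]) \<subseteq> {x. (ext.D ^^ (j - 1 - i)) x = 0}"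
          by (auto simp: u(2))
      qed
      hence "(ext.D ^^ (j - 1 - i)) ((ext.D ^^ i) y) = 0" using * u(2)[of i] by auto
      moreover have "(ext.D ^^ (j - 1 - i)) ((ext.D ^^ i) y) = (ext.D ^^ (j - 1 - i + i)) y"
        by (simp only: funpow_add o_apply)
      moreover have "j - 1 - i + i = j - 1" using i(2) by simp
      ultimately show False using D(2) by (simp add: y_def)
    qed
    moreover have "independent K (map u [Suc i..<j])" using Suc i by simp
    ultimately have "independent K (u i # map u [Suc i..<j])" using u(1) by (intro li_Cons)
    thus ?case using i(2) by (simp add: i_def upt_conv_Cons)
  qed simp
  from this[of j] have indep: "independent K Us" by (simp add: Us_def)

  define S where "S = \<psi> ` Span K Us"
  define W where "W = \<psi> ` Span K Cs"
  have S: "submodule_over (\<psi> ` K) S" and W: "submodule_over (\<psi> ` K) W"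
    unfolding S_def W_def by (rule submodule_image_Span[OF K(1)], fact)+
  have uS: "(ext.D ^^ i) y \<in> S" if "i < j" for i
    using image_set_subset_Span[OF K(1) Us] that u(2)[of i] by (force simp: S_def Us_def)
  have conjW: "y ^ (q ^ i) \<in> W" if "i < p" for i
    using image_set_subset_Span[OF K(1) Cs] that conj(2)[of i] by (force simp: W_def Cs_def)
  have DS: "ext.D x \<in> S" if "x \<in> S" for x
  proof (rule D_closed[OF S _ Us that[unfolded S_def]])
    fix v assume "v \<in> set Us"
    then obtain i where i: "i < j" "v = u i" by (auto simp: Us_def)
    have "ext.D (\<psi> v) = (ext.D ^^ Suc i) y" by (simp add: i u(2))
    also have "\<dots> \<in> S"
    proof (cases "Suc i < j")
      case False
      hence "Suc i = j" using i(1) by simp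
      thus ?thesis using D(1) submodule_overD(1)[OF S] by (simp only: y_def)
    qed (rule uS)
    finally show "ext.D (\<psi> v) \<in> S" .
  qed
  have y_p: "y ^ (q ^ p) = y" by (rule ext.frobenius_p)
  have p0: "0 < p" using ext.p_ge_2 by simp
  have neg1: "-1 \<in> \<psi> ` K"
    unfolding \<psi>K using ext.K_uminus[of 1] by (simp add: ext.K_def)
  have DW: "ext.D x \<in> W" if "x \<in> W" for x
  proof (rule D_closed[OF W _ Cs that[unfolded W_def]])
    fix v assume "v \<in> set Cs"
    then obtain i where i: "i < p" "v = conj i" by (auto simp: Cs_def)
    \<comment> \<open>Frobenius permutes the conjugates cyclically; after the last one comes
      \<open>y\<close> again.\<close>
    have "y ^ (q ^ Suc i) \<in> W"
    proof (cases "Suc i < p")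
      case False
      hence "Suc i = p" using i(1) by simp
      thus ?thesis using y_p conjW[OF p0] by simp
    qed (rule conjW)
    hence "y ^ (q ^ Suc i) + (-1) * y ^ (q ^ i) \<in> W"
      using conjW[OF i(1)] by (intro submodule_overD(2)[OF W] submodule_overD(3)[OF W neg1])
    thus "ext.D (\<psi> v) \<in> W" by (simp add: i conj(2) ext.D_def mult.commute flip: power_mult)
  qed
  have yS: "y ^ (q ^ i) \<in> S" for i
  proof (induction i)
    case 0
    thus ?case using uS[of 0] j by simp
  next
    case (Suc i)
    have "y ^ (q ^ i) + ext.D (y ^ (q ^ i)) \<in> S"
      by (intro submodule_overD(2)[OF S] DS Suc)
    thus ?case by (simp add: ext.D_def mult.commute flip: power_mult)
  qed
  have uW: "(ext.D ^^ i) y \<in> W" for i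
  proof (induction i)
    case 0
    thus ?case using conjW[OF p0] by simp
  qed (simp add: DW)
  have "S \<subseteq> W"
    unfolding S_def using uW by (intro image_Span_minimal[OF K(1) Us W]) (auto simp: Us_def u(2))
  moreover have "W \<subseteq> S"
    unfolding W_def using yS by (intro image_Span_minimal[OF K(1) Cs S]) (auto simp: Cs_def conj(2))
  ultimately have "\<psi> ` Span K Us = \<psi> ` Span K Cs" by (simp add: S_def W_def)
  hence "Span K Us = Span K Cs"
    using inj_on_image_eq_iff[OF inj Span_subgroup_props(1)[OF K(1) Us] Span_subgroup_props(1)[OF K(1) Cs]]
    by blast
  hence "dimension j K (Span K Cs)" using dimension_independent[OF indep] by (simp add: Us_def)
  thus ?thesis
    unfolding k_normal_def using \<beta> j by (simp add: Cs_def conj_def K(2))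
qed

text \<open>
  A condition on numbers only, so that the threshold for \<open>q\<close> does not depend on the type of the field.
\<close>

definition large_degree_p :: "nat \<Rightarrow> nat \<Rightarrow> bool" where
  "large_degree_p p q \<longleftrightarrow> (\<exists>C\<ge>1. (\<forall>N>0. 4 ^ card (prime_factors N) \<le> C * real N powr (1 / (32 * (real p)\<^sup>2))) \<and>
     2 * (real p + 1) * C < real q powr (1 / (32 * real p)))"

lemma large_degree_p_eventually:
  assumes "p > 0"
  shows "\<exists>c>0. \<forall>q. real q > c \<longrightarrow> large_degree_p p q"
proof -
  obtain C :: real where C: "C \<ge> 1" "\<And>N. N > 0 \<Longrightarrow> 4 ^ card (prime_factors N) \<le> C * real N powr (1 / (32 * (real p)\<^sup>2))"
    using four_power_card_prime_factors_bound[of "1 / (32 * (real p)\<^sup>2)"] assms by auto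
  \<comment> \<open>At \<open>q = c\<close> the last inequality of \<open>large_degree_p\<close> is
    an equality.\<close>
  define c where "c = (2 * (real p + 1) * C) powr (32 * real p)"
  have "c > 0" using C(1) by (simp add: c_def)
  moreover have "large_degree_p p q" if "real q > c" for q
  proof -
    have "c powr (1 / (32 * real p)) < real q powr (1 / (32 * real p))"
      using that \<open>c > 0\<close> assms by (intro powr_less_mono2) auto
    also have "c powr (1 / (32 * real p)) = 2 * (real p + 1) * C"
      using assms C(1) by (simp add: c_def powr_powr)
    finally show ?thesis unfolding large_degree_p_def using C by blast
  qed
  ultimately show ?thesis by blast
qed

text \<open>All parameters are bound inside, so that this is a property of the record alone and a
  record violating it can be chosen by a closed term.\<close>

definition has_primitive_k_normals :: "'a ring \<Rightarrow> bool" where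
  "has_primitive_k_normals F \<longleftrightarrow>
     (\<forall>p m q K k. prime p \<and> m > 0 \<and> q = p ^ m \<and> large_degree_p p q \<and> order F = q ^ p \<and>
        subfield K F \<and> card K = q \<and> k \<le> p - 2 \<longrightarrow>
        (\<exists>\<beta>. primitive_element F \<beta> \<and> k_normal F K p k \<beta>))"

text \<open>The nonzero part of the image is closed under multiplication and has
  \<open>q - 1\<close> elements, so they are roots of unity of order dividing \<open>q - 1\<close>.
  Equality follows since \<open>b ^ q = b\<close> has at most \<open>q\<close> solutions.\<close>

lemma (in field_bijection) image_subfield:
  assumes K: "subfield K F" and q: "card K = q" "q > 1"
  shows "\<psi> ` K = {b :: 'b. b ^ q = b}"
proof (rule card_seteq)
  have inj_K: "inj_on \<psi> K" using inj K_subset[OF K] by (rule inj_on_subset)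
  have "finite K" using q by (metis card.infinite not_one_less_zero)
  define S where "S = \<psi> ` K - {0}"
  have "0 \<in> \<psi> ` K" using subringE(2)[OF subfieldE(1)[OF K]] hom_zero by (metis image_eqI)
  hence card_S: "card S = q - 1"
    using \<open>finite K\<close> q by (simp add: S_def card_image[OF inj_K])
  have mult: "x * y \<in> S" if xy: "x \<in> S" "y \<in> S" for x y
  proof -
    obtain u v where uv: "u \<in> K" "v \<in> K" "x = \<psi> u" "y = \<psi> v" using xy by (auto simp: S_def)
    have "\<psi> (u \<otimes> v) \<in> \<psi> ` K" using subringE(6)[OF subfieldE(1)[OF K] uv(1,2)] by (rule imageI)
    moreover have "u \<in> carrier F" "v \<in> carrier F" using uv K_subset[OF K] by blast+
    ultimately show ?thesis using xy by (simp add: S_def hom_mult uv(3,4))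
  qed
  show "\<psi> ` K \<subseteq> {b. b ^ q = b}"
  proof
    fix b assume b: "b \<in> \<psi> ` K"
    show "b \<in> {b. b ^ q = b}"
    proof (cases "b = 0")
      case False
      hence "b ^ (q - 1) = 1"
        using power_card_mult_closed[of S b] mult b \<open>finite K\<close> unfolding card_S by (simp add: S_def)
      thus ?thesis using power_eq_if[of b q] q by simp
    qed (use q in \<open>simp add: power_0_left\<close>)
  qed
  have "{b :: 'b. b ^ q = b} \<subseteq> insert 0 {b. b ^ (q - 1) = 1}"
  proof
    fix b :: 'b assume "b \<in> {b. b ^ q = b}"
    hence "b * b ^ (q - 1) = b" using power_eq_if[of b q] q by simp
    thus "b \<in> insert 0 {b. b ^ (q - 1) = 1}" by simp
  qed
  hence "card {b :: 'b. b ^ q = b} \<le> card (insert 0 {b :: 'b. b ^ (q - 1) = 1})"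
    by (intro card_mono) auto
  also have "\<dots> \<le> Suc (card {b :: 'b. b ^ (q - 1) = 1})" by (rule card_insert_le_m1) auto
  also have "\<dots> \<le> Suc (q - 1)"
    using card_roots_of_unity_le[of "q - 1", where ?'a = 'b] q by simp
  also have "\<dots> = card (\<psi> ` K)" using q by (simp add: card_image[OF inj_K])
  finally show "card {b :: 'b. b ^ q = b} \<le> card (\<psi> ` K)" .
qed simp

theorem (in field_bijection) primitive_k_normals_exist: "has_primitive_k_normals F"
  unfolding has_primitive_k_normals_def
proof (intro allI impI, elim conjE)
  fix p m q K and k :: nat
  assume p: "prime p" and m: "m > 0" "q = p ^ m" and large: "large_degree_p p q"
    and order: "order F = q ^ p" and K: "subfield K F" "card K = q" and k: "k \<le> p - 2"
  have "1 < q" using one_less_power[of p m] prime_gt_1_nat[OF p] m by simp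
  note \<psi>K = image_subfield[OF K this]
  have card_UNIV: "card (UNIV :: 'b set) = q ^ p" using order by (simp add: card_UNIV_eq)
  obtain g :: 'b where g: "g \<noteq> 0" "\<And>x. x \<noteq> 0 \<Longrightarrow> \<exists>i. x = g ^ i" using exists_generator by blast
  have ext: "finite_field_extension g p q m"
  proof
    show "p = CHAR('b)"
      using CHAR_eq_of_CARD[OF p, of "m * p", where ?'a = 'b] card_UNIV m by (simp add: power_mult)
    have "card (\<psi> ` K) = card K" by (rule card_image[OF inj_on_subset[OF inj K_subset[OF K(1)]]])
    thus "card {b :: 'b. b ^ q = b} = q" by (simp add: \<psi>K K(2))
  qed (use m card_UNIV g in auto)
  then interpret ext: finite_field_extension g p q m .
  obtain C where C: "C \<ge> 1" "\<And>N. N > 0 \<Longrightarrow> 4 ^ card (prime_factors N) \<le> C * real N powr (1 / (32 * (real p)\<^sup>2))"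
    "2 * (real p + 1) * C < real q powr (1 / (32 * real p))"
    using large unfolding large_degree_p_def by blast
  have j: "2 \<le> p - k" "p - k \<le> p" using k ext.p_ge_2 by auto
  obtain y where y: "\<And>x. x \<noteq> 0 \<Longrightarrow> \<exists>i. x = y ^ i" "(ext.D ^^ (p - k)) y = 0" "(ext.D ^^ (p - k - 1)) y \<noteq> 0"
    using ext.exists_primitive_with_D_order[OF C j] by blast
  obtain \<beta> where \<beta>: "\<beta> \<in> carrier F" "\<psi> \<beta> = y" by (rule surj)
  have "\<beta> \<noteq> \<zero>" using y(3) \<beta>(2) hom_zero ext.D_power_0 by metis
  hence "primitive_element F \<beta>" using y(1) by (intro primitive_elementI \<beta>(1)) (auto simp: \<beta>(2))
  moreover have "k_normal F K p (p - (p - k)) \<beta>"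
    using j y(2,3) by (intro k_normalI[OF ext K \<psi>K \<beta>(1)]) (auto simp: \<beta>(2))
  moreover have "p - (p - k) = k" using k by simp
  ultimately show "\<exists>\<beta>. primitive_element F \<beta> \<and> k_normal F K p k \<beta>" by auto
qed

text \<open>
  The preceding theorem concerns fields that are types, but a type cannot depend on a given record \<open>F\<close>.
  It can, however, depend on the closed term that chooses a counterexample among all records over
  \<open>'a\<close>.  The theorem shows that the chosen field is not a counterexample, hence that there is none.
  The field with two elements is a default value, which keeps the type a field in any case.
\<close>

definition bool_field :: "bool ring" where
  "bool_field = \<lparr>carrier = UNIV, monoid.mult = (\<and>), one = True, zero = False, add = (\<noteq>)\<rparr>"

lemma field_bool_field: "field bool_field"
proof (rule cring.cring_fieldI2)
  show "cring bool_field"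
  proof (intro cringI abelian_groupI comm_monoidI)
    fix x assume "x \<in> carrier bool_field"
    show "\<exists>y\<in>carrier bool_field. y \<oplus>\<^bsub>bool_field\<^esub> x = \<zero>\<^bsub>bool_field\<^esub>"
      by (rule bexI[of _ x]) (auto simp: bool_field_def)
  qed (auto simp: bool_field_def)
qed (auto simp: bool_field_def)

definition counterexample_field :: "('a + bool) ring" where
  "counterexample_field = (if \<exists>F :: 'a ring. field F \<and> finite (carrier F) \<and> \<not> has_primitive_k_normals F
     then image_ring Inl (SOME F :: 'a ring. field F \<and> finite (carrier F) \<and> \<not> has_primitive_k_normals F)
     else image_ring Inr bool_field)"

lemma counterexample_field: "field (counterexample_field :: ('a + bool) ring)" "finite (carrier (counterexample_field :: ('a + bool) ring))"
proof -
  let ?P = "\<lambda>F :: 'a ring. field F \<and> finite (carrier F) \<and> \<not> has_primitive_k_normals F"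
  have inj: "inj_on Inl A" "inj_on Inr B" for A :: "'a set" and B :: "bool set" by auto
  have "field (counterexample_field :: ('a + bool) ring) \<and> finite (carrier (counterexample_field :: ('a + bool) ring))"
  proof (cases "\<exists>F. ?P F")
    case True
    define G where "G = (SOME F. ?P F)"
    have G: "?P G" unfolding G_def using True by (rule someI_ex)
    have tf: "counterexample_field = (image_ring Inl G :: ('a + bool) ring)"
      using True by (simp add: counterexample_field_def G_def)
    show ?thesis
      using G field.inj_imp_image_ring_is_field[OF _ inj(1), of G] by (simp add: tf image_ring_carrier)
  next
    case False
    hence tf: "counterexample_field = (image_ring Inr bool_field :: ('a + bool) ring)"
      unfolding counterexample_field_def by (rule if_not_P)
    show ?thesis
      using field.inj_imp_image_ring_is_field[OF field_bool_field inj(2)]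
      by (simp add: tf image_ring_carrier)
  qed
  thus "field (counterexample_field :: ('a + bool) ring)" "finite (carrier (counterexample_field :: ('a + bool) ring))" by auto
qed

interpretation counterexample_field: field "counterexample_field :: ('a + bool) ring"
  by (rule counterexample_field)

section \<open>The chosen field as a type\<close>

typedef 'a counterexample_elem = "carrier (counterexample_field :: ('a + bool) ring)"
  by blast

setup_lifting type_definition_counterexample_elem

instantiation counterexample_elem :: (type) field
begin

lift_definition zero_counterexample_elem :: "'a counterexample_elem" is "\<zero>\<^bsub>counterexample_field\<^esub>"
  by (rule counterexample_field.zero_closed)

lift_definition one_counterexample_elem :: "'a counterexample_elem" is "\<one>\<^bsub>counterexample_field\<^esub>"
  by (rule counterexample_field.one_closed)

lift_definition plus_counterexample_elem :: "'a counterexample_elem \<Rightarrow> 'a counterexample_elem \<Rightarrow> 'a counterexample_elem"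
  is "\<lambda>x y. x \<oplus>\<^bsub>counterexample_field\<^esub> y"
  by (rule counterexample_field.add.m_closed)

lift_definition times_counterexample_elem :: "'a counterexample_elem \<Rightarrow> 'a counterexample_elem \<Rightarrow> 'a counterexample_elem"
  is "\<lambda>x y. x \<otimes>\<^bsub>counterexample_field\<^esub> y"
  by (rule counterexample_field.m_closed)

lift_definition uminus_counterexample_elem :: "'a counterexample_elem \<Rightarrow> 'a counterexample_elem"
  is "\<lambda>x. \<ominus>\<^bsub>counterexample_field\<^esub> x"
  by (rule counterexample_field.add.inv_closed)

text \<open>The class \<open>field\<close> demands \<open>inverse 0 = 0\<close>, hence the separate
  case.\<close>

lift_definition inverse_counterexample_elem :: "'a counterexample_elem \<Rightarrow> 'a counterexample_elem"
  is "\<lambda>x. if x = \<zero>\<^bsub>counterexample_field\<^esub> then \<zero>\<^bsub>counterexample_field\<^esub> else inv\<^bsub>counterexample_field\<^esub> x"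
  by (auto simp: counterexample_field.field_Units)

definition minus_counterexample_elem :: "'a counterexample_elem \<Rightarrow> 'a counterexample_elem \<Rightarrow> 'a counterexample_elem"
  where "minus_counterexample_elem x y = x + - y"

definition divide_counterexample_elem :: "'a counterexample_elem \<Rightarrow> 'a counterexample_elem \<Rightarrow> 'a counterexample_elem"
  where "divide_counterexample_elem x y = x * inverse y"

instance
proof
  fix a b c :: "'a counterexample_elem"
  show "a * b * c = a * (b * c)" by transfer (rule counterexample_field.m_assoc)
  show "a * b = b * a" by transfer (rule counterexample_field.m_comm)
  show "1 * a = a" by transfer (rule counterexample_field.l_one)
  show "a + b + c = a + (b + c)" by transfer (rule counterexample_field.a_assoc)
  show "a + b = b + a" by transfer (rule counterexample_field.a_comm)
  show "0 + a = a" by transfer (rule counterexample_field.l_zero)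
  show "- a + a = 0" by transfer (rule counterexample_field.l_neg)
  show "a - b = a + - b" by (rule minus_counterexample_elem_def)
  show "(a + b) * c = a * c + b * c" by transfer (rule counterexample_field.l_distr)
  show "(0 :: 'a counterexample_elem) \<noteq> 1" by transfer (rule counterexample_field.one_not_zero[symmetric])
  show "a div b = a * inverse b" by (rule divide_counterexample_elem_def)
  show "inverse (0 :: 'a counterexample_elem) = 0" by transfer simp
  show "a \<noteq> 0 \<Longrightarrow> inverse a * a = 1"
    by transfer (simp add: counterexample_field.field_Units)
qed

end

instance counterexample_elem :: (type) finite_field
proof (rule finite_fieldI)
  have "(UNIV :: 'a counterexample_elem set) = Abs_counterexample_elem ` carrier counterexample_field"
    by (metis type_definition.Abs_image type_definition_counterexample_elem)
  thus "finite (UNIV :: 'a counterexample_elem set)" using counterexample_field(2) by (metis finite_imageI)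
qed

lemma has_primitive_k_normals_all:
  assumes "field F" "finite (carrier F)"
  shows "has_primitive_k_normals F"
proof (rule ccontr)
  let ?P = "\<lambda>F :: 'a ring. field F \<and> finite (carrier F) \<and> \<not> has_primitive_k_normals F"
  assume "\<not> has_primitive_k_normals F"
  hence ex: "\<exists>F. ?P F" using assms by blast
  \<comment> \<open>The same choice as in \<open>counterexample_field\<close>, so the type is a copy
    of \<open>G\<close>, which may differ from \<open>F\<close>. The contradiction is reached for
    \<open>G\<close>.\<close>
  define G where "G = (SOME F. ?P F)"
  have G: "?P G" unfolding G_def using ex by (rule someI_ex)
  have tf: "counterexample_field = (image_ring Inl G :: ('a + bool) ring)"
    using ex by (simp add: counterexample_field_def G_def)
  define \<psi> :: "'a \<Rightarrow> 'a counterexample_elem" where "\<psi> = (\<lambda>x. Abs_counterexample_elem (Inl x))"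
  have iso: "Inl \<in> ring_iso G (counterexample_field :: ('a + bool) ring)"
    unfolding tf by (rule inj_imp_image_ring_iso) auto
  have carrier: "Inl ` carrier G = carrier (counterexample_field :: ('a + bool) ring)"
    by (simp add: tf image_ring_carrier)
  have mem: "(Inl x :: 'a + bool) \<in> carrier counterexample_field" if "x \<in> carrier G" for x
    using that unfolding carrier[symmetric] by (rule imageI)
  have "field_bijection G \<psi>"
  proof (intro field_bijection.intro field_bijection_axioms.intro)
    show "field G" using G by blast
    have "bij_betw Inl (carrier G) (carrier (counterexample_field :: ('a + bool) ring))"
      using carrier by (simp add: bij_betw_def)
    moreover have "bij_betw Abs_counterexample_elem (carrier counterexample_field) (UNIV :: 'a counterexample_elem set)"
      by (metis bij_betw_def inj_onI Abs_counterexample_elem_inject type_definition.Abs_image type_definition_counterexample_elem)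
    ultimately show "bij_betw \<psi> (carrier G) UNIV"
      unfolding \<psi>_def using bij_betw_trans by (fastforce simp: o_def)
  next
    fix x y assume x: "x \<in> carrier G" and y: "y \<in> carrier G"
    have "Inl (x \<otimes>\<^bsub>G\<^esub> y) = Inl x \<otimes>\<^bsub>counterexample_field\<^esub> (Inl y :: 'a + bool)"
      using iso x y unfolding ring_iso_def ring_hom_def by blast
    thus "\<psi> (x \<otimes>\<^bsub>G\<^esub> y) = \<psi> x * \<psi> y"
      by (simp add: \<psi>_def times_counterexample_elem.abs_eq eq_onp_def mem x y)
    have "Inl (x \<oplus>\<^bsub>G\<^esub> y) = Inl x \<oplus>\<^bsub>counterexample_field\<^esub> (Inl y :: 'a + bool)"
      using iso x y unfolding ring_iso_def ring_hom_def by blast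
    thus "\<psi> (x \<oplus>\<^bsub>G\<^esub> y) = \<psi> x + \<psi> y"
      by (simp add: \<psi>_def plus_counterexample_elem.abs_eq eq_onp_def mem x y)
  next
    have "(Inl \<one>\<^bsub>G\<^esub> :: 'a + bool) = \<one>\<^bsub>counterexample_field\<^esub>"
      using iso unfolding ring_iso_def ring_hom_def by blast
    thus "\<psi> \<one>\<^bsub>G\<^esub> = 1"
      by (simp add: \<psi>_def one_counterexample_elem.abs_eq)
  qed
  thus False using G field_bijection.primitive_k_normals_exist by blast
qed

theorem corollary4p8:
  fixes p :: nat
  assumes "prime p"
  shows "\<exists>c::real. c > 0 \<and>
    (\<forall>q::nat. (\<exists>m>0. q = p ^ m) \<and> real q > c \<longrightarrow>
      (\<forall>(F :: 'a ring) K. field F \<and> order F = q ^ p \<and> subfield K F \<and> card K = q \<longrightarrow>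
        (\<forall>k::nat. k \<le> p - 2 \<longrightarrow>
          (\<exists>\<beta>. primitive_element F \<beta> \<and> k_normal F K p k \<beta>))))"
proof -
  obtain c where c: "c > 0" "\<And>q. real q > c \<Longrightarrow> large_degree_p p q"
    using large_degree_p_eventually[OF prime_gt_0_nat[OF assms]] by blast
  have "\<exists>\<beta>. primitive_element F \<beta> \<and> k_normal F K p k \<beta>"
    if q: "m > 0" "q = p ^ m" "real q > c" and F: "field F" "order F = q ^ p" "subfield K F" "card K = q"
      and k: "k \<le> p - 2" for q m k K and F :: "'a ring"
  proof -
    \<comment> \<open>The order of an infinite carrier is \<open>0\<close>, so a positive order
      implies finiteness.\<close>
    have "order F > 0" using F(2) q prime_gt_0_nat[OF assms] by simp
    hence "finite (carrier F)" by (simp add: Coset.order_def card_gt_0_iff)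
    hence "has_primitive_k_normals F" using F(1) by (intro has_primitive_k_normals_all)
    thus ?thesis using assms q c(2) F k unfolding has_primitive_k_normals_def by blast
  qed
  thus ?thesis using c(1) by (intro exI[of _ c]) blast
qed

end
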